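(* Let $m$ and $W$ satisfy the assumptions in the context, let $\mu\in(0,1)$, and fix $e\in S^{d-1}\setminus\mathbb{R}\mathbb{Z}^d$. For every $\nu>0$ there is a function $\tilde P_e^\nu\in C^{2,\mu}(\mathbb{R}\times\mathbb{T}^d)$ such that $$\Big|[m(y,\dot q(s)e)-\overline m(e)]\,\dot q(s)+\mathcal{D}_e^*\mathcal{D}_e\tilde P_e^\nu(s,y)+W''(q(s))\tilde P_e^\nu(s,y)\Big|\le\nu\,\dot q(s)\quad\text{for all }(s,y)\in\mathbb{R}\times\mathbb{T}^d,$$ where $$\overline m(e)=c_W^{-1}\int_{\mathbb{R}\times\mathbb{T}^d}m(y,\dot q(s)e)\dot q(s)^2\,dy\,ds,\qquad c_W=\int_{-\infty}^\infty\dot q(s)^2\,ds.$$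
   Context: $\mathbb{T}^d=\mathbb{R}^d/\mathbb{Z}^d$; $\mathbb{R}\mathbb{Z}^d=\{\lambda k:\lambda\in\mathbb{R},k\in\mathbb{Z}^d\}$. For functions of $(s,y)\in\mathbb{R}\times\mathbb{T}^d$, $\mathcal{D}_e=e\,\partial_s+D_y$ and $\mathcal{D}_e^*$ is its formal adjoint, so $\mathcal{D}_e^*\mathcal{D}_eP=-(\partial_{s}^2P+2\langle e,D_y\partial_sP\rangle+\Delta_yP)$. Assumptions on $m$: $m\in C(\mathbb{T}^d\times\mathbb{R}^d)$; $0<\theta:=\min m$; $\Theta:=\max m<\infty$; $\sup\{|m(y,v)-m(y',v)|/\|y-y'\|:y\ne y' \in \mathbb{T}^d, v \in \mathbb{R}^d\}<\infty$. Assumptions on $W$: $W\in C^3([-1,1])$, $W\ge0$, $\{W=0\}=\{-1,1\}$, $\{W'=0\}=\{-1,0,1\}$, $W'>0$ on $(-1,0)$, $W'<0$ on $(0,1)$, $W''(\pm1)>0$, $W''(0)<0$. $q:\mathbb{R}\to(-1,1)$ is the unique strictly increasing solution of $-\ddot q+W'(q)=0$ in $\mathbb{R}$ with $\lim_{s\to\pm\infty}q(s)=\pm1$, $q(0)=0$. *)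

theory Defs
  imports "HOL-Analysis.Analysis"
begin

text \<open>Functions on the torus \<open>R^d / Z^d\<close> are represented by their \<open>Z^d\<close>-periodic lifts to \<open>R^d\<close>.\<close>

definition int_lattice :: "(real ^ 'd) set" where
  "int_lattice = {k. \<forall>i. k $ i \<in> \<int>}"

definition rational_directions :: "(real ^ 'd) set" where
  "rational_directions = {r *\<^sub>R k | r k. k \<in> int_lattice}"

text \<open>\<open>torus_norm (y - y')\<close> is the distance of the classes of \<open>y\<close> and \<open>y'\<close> in the torus.\<close>

definition torus_norm :: "real ^ 'd \<Rightarrow> real" where
  "torus_norm y = (INF k\<in>int_lattice. norm (y + k))"

definition dir_deriv :: "'a::real_normed_vector \<Rightarrow> ('a \<Rightarrow> real) \<Rightarrow> 'a \<Rightarrow> real" where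
  "dir_deriv v f z = deriv (\<lambda>t. f (z + t *\<^sub>R v)) 0"

definition C1 :: "('a::euclidean_space \<Rightarrow> real) \<Rightarrow> bool" where
  "C1 f \<longleftrightarrow> continuous_on UNIV f \<and>
     (\<forall>b\<in>Basis. (\<forall>z. (\<lambda>t. f (z + t *\<^sub>R b)) differentiable (at 0)) \<and>
                continuous_on UNIV (dir_deriv b f))"

definition C2 :: "('a::euclidean_space \<Rightarrow> real) \<Rightarrow> bool" where
  "C2 f \<longleftrightarrow> C1 f \<and> (\<forall>b\<in>Basis. C1 (dir_deriv b f))"

text \<open>The space of all functions on \<open>R \<times> T^d\<close> with finite \<open>C^{2,\<mu>}\<close> norm: all derivatives up to
  order two are bounded, and those of order two are globally \<open>\<mu>\<close>-Hoelder with respect to the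
  product distance of \<open>R \<times> T^d\<close>.\<close>

definition C2_holder :: "real \<Rightarrow> (real \<times> (real ^ 'd) \<Rightarrow> real) set" where
  "C2_holder \<mu> = {P.
     (\<forall>s y. \<forall>k\<in>int_lattice. P (s, y + k) = P (s, y)) \<and>
     C2 P \<and>
     bounded (range P) \<and>
     (\<forall>b\<in>Basis. bounded (range (dir_deriv b P))) \<and>
     (\<forall>b\<in>Basis. \<forall>b'\<in>Basis.
        bounded (range (dir_deriv b (dir_deriv b' P))) \<and>
        (\<exists>C. \<forall>s y s' y'.
           \<bar>dir_deriv b (dir_deriv b' P) (s, y) - dir_deriv b (dir_deriv b' P) (s', y')\<bar>
             \<le> C * norm (s - s', torus_norm (y - y')) powr \<mu>))}"

definition d_s :: "(real \<times> (real ^ 'd) \<Rightarrow> real) \<Rightarrow> real \<times> (real ^ 'd) \<Rightarrow> real" where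
  "d_s = dir_deriv (1, 0)"

definition d_y :: "'d::finite \<Rightarrow> (real \<times> (real ^ 'd) \<Rightarrow> real) \<Rightarrow> real \<times> (real ^ 'd) \<Rightarrow> real" where
  "d_y i = dir_deriv (0, axis i 1)"

definition D_op :: "real ^ 'd \<Rightarrow> (real \<times> (real ^ 'd) \<Rightarrow> real) \<Rightarrow> real \<times> (real ^ 'd) \<Rightarrow> real ^ 'd" where
  "D_op e P z = d_s P z *\<^sub>R e + (\<chi> i. d_y i P z)"

text \<open>The formal adjoint, obtained from integration by parts:
  \<open>D_e^* F = - (\<langle>e, \<partial>\<^sub>s F\<rangle> + div\<^sub>y F)\<close> for vector fields \<open>F\<close>.\<close>

definition D_adj :: "real ^ 'd \<Rightarrow> (real \<times> (real ^ 'd) \<Rightarrow> real ^ 'd) \<Rightarrow> real \<times> (real ^ 'd) \<Rightarrow> real" where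
  "D_adj e F z = - (\<Sum>i\<in>UNIV. e $ i * d_s (\<lambda>w. F w $ i) z + d_y i (\<lambda>w. F w $ i) z)"

text \<open>\<open>m (y, v)\<close> is periodic in \<open>y\<close>. Since the velocity variable is unbounded, extrema are read as
  infimum and supremum.\<close>

definition admissible_mobility :: "((real ^ 'd) \<times> (real ^ 'd) \<Rightarrow> real) \<Rightarrow> bool" where
  "admissible_mobility m \<longleftrightarrow>
     (\<forall>y v. \<forall>k\<in>int_lattice. m (y + k, v) = m (y, v)) \<and>
     continuous_on UNIV m \<and>
     bdd_below (range m) \<and> 0 < (INF z. m z) \<and>
     bdd_above (range m) \<and>
     bdd_above {\<bar>m (y, v) - m (y', v)\<bar> / torus_norm (y - y') | y y' v. y - y' \<notin> int_lattice}"

text \<open>Derivative on \<open>[-1, 1]\<close>, one-sided at the end points.\<close>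

definition icc_deriv :: "(real \<Rightarrow> real) \<Rightarrow> real \<Rightarrow> real" where
  "icc_deriv f x = vector_derivative f (at x within {-1..1})"

definition double_well :: "(real \<Rightarrow> real) \<Rightarrow> bool" where
  "double_well W \<longleftrightarrow>
     (\<forall>j<3. (icc_deriv ^^ j) W differentiable_on {-1..1}) \<and>
     continuous_on {-1..1} ((icc_deriv ^^ 3) W) \<and>
     (\<forall>x\<in>{-1..1}. 0 \<le> W x) \<and>
     {x\<in>{-1..1}. W x = 0} = {-1, 1} \<and>
     {x\<in>{-1..1}. icc_deriv W x = 0} = {-1, 0, 1} \<and>
     (\<forall>x\<in>{-1<..<0}. 0 < icc_deriv W x) \<and>
     (\<forall>x\<in>{0<..<1}. icc_deriv W x < 0) \<and>
     0 < icc_deriv (icc_deriv W) (-1) \<and>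
     0 < icc_deriv (icc_deriv W) 1 \<and>
     icc_deriv (icc_deriv W) 0 < 0"

definition standing_wave :: "(real \<Rightarrow> real) \<Rightarrow> (real \<Rightarrow> real) \<Rightarrow> bool" where
  "standing_wave W q \<longleftrightarrow>
     range q \<subseteq> {-1<..<1} \<and>
     strict_mono q \<and>
     (\<forall>s. q differentiable (at s) \<and> deriv q differentiable (at s) \<and>
          - deriv (deriv q) s + icc_deriv W (q s) = 0) \<and>
     (q \<longlongrightarrow> 1) at_top \<and> (q \<longlongrightarrow> -1) at_bot \<and>
     q 0 = 0"

definition c_wave :: "(real \<Rightarrow> real) \<Rightarrow> real" where
  "c_wave q = (LINT s|lborel. (deriv q s)\<^sup>2)"

text \<open>Integration over the torus is integration over the unit cube \<open>cbox 0 1\<close>.\<close>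

definition mean_mobility ::
  "((real ^ 'd) \<times> (real ^ 'd) \<Rightarrow> real) \<Rightarrow> (real \<Rightarrow> real) \<Rightarrow> real ^ 'd \<Rightarrow> real" where
  "mean_mobility m q e =
     inverse (c_wave q) *
     (LINT z:UNIV \<times> cbox 0 1|lborel.
        m (snd z, deriv q (fst z) *\<^sub>R e) * (deriv q (fst z))\<^sup>2)"

end

theory Submission
  imports Defs
begin

text \<open>
  The equation is solved with zero error for a dense class of mobilities; \<open>\<nu>\<close> only pays for the
  density. Since \<open>q'\<close> takes values in a compact interval, \<open>m (y, t e)\<close> is needed for bounded \<open>t\<close>
  only, where it is a continuous function of \<open>(t, y)\<close>, periodic in \<open>y\<close>. By Stone-Weierstrass it is
  uniformly \<open>\<nu>/2\<close>-close to a finite sum of modes \<open>c t^n cos (2\<pi> k \<bullet> y + \<phi>)\<close> with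
  \<open>k\<close> in the integer lattice (\<open>trig_poly_dense\<close>). The average in the statement is taken against a
  probability density, so it moves by at most \<open>\<nu>/2\<close> too (\<open>wave_mean_diff_le\<close>). The equation being
  linear, it remains to solve it exactly for one mode (\<open>mode_solvable\<close>, \<open>trig_poly_solvable\<close>).

  For one mode, the right variable is \<open>y - s e\<close>: the operator \<open>e \<partial>\<^sub>s + D\<^sub>y\<close> maps the phase
  \<open>2\<pi> k \<bullet> (y - s e)\<close> to the constant vector \<open>2\<pi> (k - (k \<bullet> e) e)\<close>, which is orthogonal to \<open>e\<close>. All
  mixed terms therefore cancel, and the operator of the statement acts on
  \<open>r(s) cos (2\<pi> k \<bullet> (y - s e) + \<psi>)\<close> as the ordinary differential operator
  \<open>- r'' + (\<omega> + W''(q)) r\<close> with \<open>\<omega> = 4\<pi>\<^sup>2 (|k|\<^sup>2 - (k \<bullet> e)\<^sup>2)\<close> (\<open>D_adj_D_op_plane_mode\<close>). The forcing is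
  \<open>q' h\<close> with \<open>h\<close> bounded.

  If \<open>k \<noteq> 0\<close>, then \<open>\<omega> > 0\<close> because \<open>e\<close> is not a multiple of a lattice vector. The function
  \<open>q' > 0\<close> solves \<open>- (q')'' + W''(q) q' = 0\<close>, so it is a strict supersolution of the shifted operator,
  and the equation becomes a contraction in the norm \<open>sup |r| / q'\<close> (\<open>schroedinger_resolvent\<close>).

  If \<open>k = 0\<close>, then \<open>\<omega> = 0\<close> and \<open>q'\<close> spans the kernel. Subtracting the average is exactly the
  solvability condition that the forcing be orthogonal to \<open>q'\<close>, and reduction of order gives a
  solution (\<open>solvable_at_zero\<close>). It stays bounded because \<open>W\<close> grows quadratically at its wells.

  In both cases the coefficients are Lipschitz along the wave, so \<open>r''\<close> is bounded and Lipschitz,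
  which is more than the Hoelder regularity that is asked for.
\<close>

section \<open>Bounded solutions of linear equations on the line\<close>

lemma antiderivative_exists:
  fixes f :: "real \<Rightarrow> real"
  assumes "continuous_on UNIV f"
  obtains F where "\<And>x. (F has_real_derivative f x) (at x)"
proof -
  have "\<exists>F. \<forall>x :: real. -\<infinity> < ereal x \<longrightarrow> ereal x < \<infinity> \<longrightarrow> (F has_vector_derivative f x) (at x)"
    using assms by (intro einterval_antiderivative) (auto simp: continuous_on_eq_continuous_at)
  then show ?thesis
    using that by (auto simp: has_real_derivative_iff_has_vector_derivative)
qed

lemma increment_le_of_deriv_le:
  fixes F g :: "real \<Rightarrow> real"
  assumes F: "\<And>x. (F has_real_derivative f x) (at x)"
    and g: "\<And>x. (g has_real_derivative g' x) (at x)"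
    and le: "\<And>x. a \<le> x \<Longrightarrow> x \<le> b \<Longrightarrow> \<bar>f x\<bar> \<le> g' x"
    and "a \<le> b"
  shows "\<bar>F b - F a\<bar> \<le> g b - g a"
proof -
  have "g a - F a \<le> g b - F b"
    by (rule DERIV_nonneg_imp_nondecreasing[OF \<open>a \<le> b\<close>, of "\<lambda>x. g x - F x"])
      (use le in \<open>fastforce intro!: derivative_eq_intros F g exI simp: abs_le_iff\<close>)
  moreover have "g a + F a \<le> g b + F b"
    by (rule DERIV_nonneg_imp_nondecreasing[OF \<open>a \<le> b\<close>, of "\<lambda>x. g x + F x"])
      (use le in \<open>fastforce intro!: derivative_eq_intros F g exI simp: abs_le_iff\<close>)
  ultimately show ?thesis by linarith
qed

text \<open>Any antiderivative inherits the Cauchy property at \<open>-\<infinity>\<close> from the majorant \<open>g\<close>, so it has a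
  limit there, which can be subtracted. This replaces the improper integral from \<open>-\<infinity>\<close>.\<close>

lemma antiderivative_vanishing_at_bot:
  fixes f g :: "real \<Rightarrow> real"
  assumes cont: "continuous_on UNIV f"
    and g: "\<And>x. (g has_real_derivative g' x) (at x)"
    and le: "\<And>x. \<bar>f x\<bar> \<le> g' x"
    and lim: "(g \<longlongrightarrow> l) at_bot"
  obtains F where "\<And>x. (F has_real_derivative f x) (at x)" "\<And>x. \<bar>F x\<bar> \<le> g x - l"
proof -
  obtain F where F: "\<And>x. (F has_real_derivative f x) (at x)"
    using antiderivative_exists[OF cont] by blast
  have inc: "\<bar>F b - F a\<bar> \<le> \<bar>g b - g a\<bar>" for a b
  proof (cases "a \<le> b")
    case True
    then show ?thesis
      using increment_le_of_deriv_le[of F f g g' a b] F g le by fastforce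
  next
    case False
    then show ?thesis
      using increment_le_of_deriv_le[of F f g g' b a] F g le by fastforce
  qed
  have glim: "(\<lambda>n. g (- real n)) \<longlonglongrightarrow> l"
    by (rule filterlim_compose[OF lim]) (simp add: filterlim_real_sequentially filterlim_uminus_at_bot)
  have "Cauchy (\<lambda>n. F (- real n))"
  proof (rule metric_CauchyI)
    fix e :: real assume "e > 0"
    from glim have "Cauchy (\<lambda>n. g (- real n))"
      using LIMSEQ_imp_Cauchy by blast
    then obtain M where "\<forall>m\<ge>M. \<forall>n\<ge>M. dist (g (- real m)) (g (- real n)) < e"
      using \<open>e > 0\<close> metric_CauchyD by blast
    then have "\<forall>m\<ge>M. \<forall>n\<ge>M. dist (F (- real m)) (F (- real n)) < e"
      using inc by (metis dist_real_def le_less_trans)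
    then show "\<exists>M. \<forall>m\<ge>M. \<forall>n\<ge>M. dist (F (- real m)) (F (- real n)) < e" by blast
  qed
  then obtain L where L: "(\<lambda>n. F (- real n)) \<longlonglongrightarrow> L"
    using Cauchy_convergent convergent_def by blast
  show ?thesis
  proof
    show "((\<lambda>x. F x - L) has_real_derivative f x) (at x)" for x
      using F[of x] by (auto intro!: derivative_eq_intros)
    show "\<bar>F x - L\<bar> \<le> g x - l" for x
    proof (rule tendsto_le[OF _ _ _])
      show "(\<lambda>n. \<bar>F x - F (- real n)\<bar>) \<longlonglongrightarrow> \<bar>F x - L\<bar>" by (intro tendsto_intros L)
      show "(\<lambda>n. g x - g (- real n)) \<longlonglongrightarrow> g x - l" by (intro tendsto_intros glim)
      show "\<forall>\<^sub>F n in sequentially. \<bar>F x - F (- real n)\<bar> \<le> g x - g (- real n)"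
      proof (rule eventually_sequentiallyI[of "nat \<lceil>\<bar>x\<bar>\<rceil>"])
        fix n assume "nat \<lceil>\<bar>x\<bar>\<rceil> \<le> n"
        then have "- real n \<le> x" by linarith
        then show "\<bar>F x - F (- real n)\<bar> \<le> g x - g (- real n)"
          using increment_le_of_deriv_le[of F f g g' "- real n" x] F g le by blast
      qed
    qed simp
  qed
qed

text \<open>Variation of constants from \<open>-\<infinity>\<close>: the weight \<open>exp (\<kappa> s)\<close> makes the forcing integrable there.\<close>

lemma decay_equation_solvable:
  fixes f :: "real \<Rightarrow> real"
  assumes "0 < \<kappa>" "continuous_on UNIV f" "\<And>s. \<bar>f s\<bar> \<le> C"
  obtains v where "\<And>s. (v has_real_derivative f s - \<kappa> * v s) (at s)" "\<And>s. \<bar>v s\<bar> \<le> C / \<kappa>"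
proof -
  have lim: "((\<lambda>s. C / \<kappa> * exp (\<kappa> * s)) \<longlongrightarrow> 0) at_bot"
  proof -
    have "filterlim (\<lambda>s. \<kappa> * s) at_bot at_bot"
      using filterlim_tendsto_pos_mult_at_bot[OF tendsto_const \<open>0 < \<kappa>\<close> filterlim_ident] .
    then have "((\<lambda>s. exp (\<kappa> * s)) \<longlongrightarrow> 0) at_bot"
      by (rule filterlim_compose[OF exp_at_bot])
    then show ?thesis using tendsto_mult_right_zero by blast
  qed
  obtain F where F: "\<And>s. (F has_real_derivative exp (\<kappa> * s) * f s) (at s)"
      "\<And>s. \<bar>F s\<bar> \<le> C / \<kappa> * exp (\<kappa> * s) - 0"
  proof (rule antiderivative_vanishing_at_bot[OF _ _ _ lim, of "\<lambda>s. exp (\<kappa> * s) * f s" "\<lambda>s. C * exp (\<kappa> * s)"])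
    show "continuous_on UNIV (\<lambda>s. exp (\<kappa> * s) * f s)" by (intro continuous_intros assms)
    show "((\<lambda>s. C / \<kappa> * exp (\<kappa> * s)) has_real_derivative C * exp (\<kappa> * x)) (at x)" for x
      using \<open>0 < \<kappa>\<close> by (auto intro!: derivative_eq_intros)
    show "\<bar>exp (\<kappa> * x) * f x\<bar> \<le> C * exp (\<kappa> * x)" for x
      using assms(3)[of x] by (simp add: abs_mult)
  qed (use that in blast)
  show ?thesis
  proof
    show "((\<lambda>s. exp (- \<kappa> * s) * F s) has_real_derivative f s - \<kappa> * (exp (- \<kappa> * s) * F s)) (at s)" for s
      by (auto intro!: derivative_eq_intros F simp: algebra_simps simp flip: exp_add)
    show "\<bar>exp (- \<kappa> * s) * F s\<bar> \<le> C / \<kappa>" for s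
    proof -
      have "exp (- \<kappa> * s) * \<bar>F s\<bar> \<le> exp (- \<kappa> * s) * (C / \<kappa> * exp (\<kappa> * s))"
        using F(2)[of s] by (intro mult_left_mono) auto
      also have "\<dots> = C / \<kappa>" by (simp add: exp_minus field_simps)
      finally show ?thesis by (simp add: abs_mult)
    qed
  qed
qed

lemma growth_equation_solvable:
  fixes f :: "real \<Rightarrow> real"
  assumes "0 < \<kappa>" "continuous_on UNIV f" "\<And>s. \<bar>f s\<bar> \<le> C"
  obtains u where "\<And>s. (u has_real_derivative \<kappa> * u s - f s) (at s)" "\<And>s. \<bar>u s\<bar> \<le> C / \<kappa>"
proof -
  have "continuous_on UNIV (\<lambda>s. f (- s))"
    by (intro continuous_on_compose2[OF assms(2)] continuous_intros) auto
  then obtain v where v: "\<And>s. (v has_real_derivative f (- s) - \<kappa> * v s) (at s)" "\<And>s. \<bar>v s\<bar> \<le> C / \<kappa>"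
    using decay_equation_solvable[of \<kappa> "\<lambda>s. f (- s)" C] assms by blast
  show ?thesis
  proof
    show "((\<lambda>s. v (- s)) has_real_derivative \<kappa> * v (- s) - f s) (at s)" for s
      using v(1)[of "- s"] by (simp add: DERIV_mirror)
  qed (use v in auto)
qed

text \<open>The operator \<open>\<kappa>\<^sup>2 - \<partial>\<^sup>2\<close> factors as \<open>(\<kappa> + \<partial>) (\<kappa> - \<partial>)\<close>; the first factor is inverted
  from \<open>-\<infinity>\<close> and the second from \<open>+\<infinity>\<close>, so that both solutions stay bounded.\<close>

lemma helmholtz_equation_solvable:
  fixes f :: "real \<Rightarrow> real"
  assumes "0 < \<kappa>" "continuous_on UNIV f" "bounded (range f)"
  obtains u u1 where "\<And>s. (u has_real_derivative u1 s) (at s)"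
    "\<And>s. (u1 has_real_derivative \<kappa>\<^sup>2 * u s - f s) (at s)" "bounded (range u)" "bounded (range u1)"
proof -
  obtain C where C: "\<And>s. \<bar>f s\<bar> \<le> C"
    using assms(3) by (auto simp: bounded_iff)
  obtain v where v: "\<And>s. (v has_real_derivative f s - \<kappa> * v s) (at s)" "\<And>s. \<bar>v s\<bar> \<le> C / \<kappa>"
    using decay_equation_solvable[OF assms(1,2) C] by blast
  have "continuous_on UNIV v"
    using v(1) by (meson DERIV_isCont continuous_at_imp_continuous_on)
  then obtain u where u: "\<And>s. (u has_real_derivative \<kappa> * u s - v s) (at s)" "\<And>s. \<bar>u s\<bar> \<le> C / \<kappa> / \<kappa>"
    using growth_equation_solvable[of \<kappa> v "C / \<kappa>"] assms(1) v(2) by blast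
  have bu: "bounded (range u)" "bounded (range v)"
    using u v by (auto simp: bounded_iff)
  show ?thesis
  proof (rule that[of u "\<lambda>s. \<kappa> * u s - v s"])
    show "((\<lambda>s. \<kappa> * u s - v s) has_real_derivative \<kappa>\<^sup>2 * u s - f s) (at s)" for s
      by (auto intro!: derivative_eq_intros u v simp: power2_eq_square algebra_simps)
    have "bounded (range (\<lambda>s. \<kappa> * u s))"
      using bounded_scaling[OF bu(1), of \<kappa>] by (simp add: image_image)
    from bounded_minus_comp[OF this bu(2)] show "bounded (range (\<lambda>s. \<kappa> * u s - v s))" .
  qed (use u bu in auto)
qed

lemma mono_tendsto_zero_at_bot_nonneg:
  fixes F :: "real \<Rightarrow> real"
  assumes "\<And>x y. x \<le> y \<Longrightarrow> F x \<le> F y" "(F \<longlongrightarrow> 0) at_bot"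
  shows "0 \<le> F s"
proof (rule tendsto_upperbound[OF assms(2)])
  show "\<forall>\<^sub>F x in at_bot. F x \<le> F s"
    using eventually_le_at_bot[of s] by (rule eventually_mono) (rule assms(1))
qed simp

text \<open>The product \<open>exp (\<kappa> s) v(s)\<close> is nondecreasing and tends to \<open>0\<close> at \<open>-\<infinity>\<close>.\<close>

lemma decay_inequality_nonneg:
  fixes v :: "real \<Rightarrow> real"
  assumes "0 < \<kappa>" "\<And>s. (v has_real_derivative v1 s) (at s)" "\<And>s. 0 \<le> v1 s + \<kappa> * v s"
    and "bounded (range v)"
  shows "0 \<le> v s"
proof -
  have lim: "((\<lambda>s. exp (\<kappa> * s)) \<longlongrightarrow> 0) at_bot"
    using filterlim_tendsto_pos_mult_at_bot[OF tendsto_const \<open>0 < \<kappa>\<close> filterlim_ident]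
    by (rule filterlim_compose[OF exp_at_bot])
  have "0 \<le> exp (\<kappa> * s) * v s"
  proof (rule mono_tendsto_zero_at_bot_nonneg[of "\<lambda>s. exp (\<kappa> * s) * v s"])
    fix x y :: real assume "x \<le> y"
    show "exp (\<kappa> * x) * v x \<le> exp (\<kappa> * y) * v y"
    proof (rule DERIV_nonneg_imp_nondecreasing[OF \<open>x \<le> y\<close>])
      fix t
      have "((\<lambda>s. exp (\<kappa> * s) * v s) has_real_derivative exp (\<kappa> * t) * (v1 t + \<kappa> * v t)) (at t)"
        by (auto intro!: derivative_eq_intros assms simp: algebra_simps)
      then show "\<exists>y. ((\<lambda>s. exp (\<kappa> * s) * v s) has_real_derivative y) (at t) \<and> 0 \<le> y"
        using assms(3)[of t] by force
    qed
  next
    show "((\<lambda>s. exp (\<kappa> * s) * v s) \<longlongrightarrow> 0) at_bot"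
    proof -
      obtain C where C: "\<And>s. \<bar>v s\<bar> \<le> C" using assms(4) by (auto simp: bounded_iff)
      show ?thesis
      proof (rule Lim_null_comparison)
        show "\<forall>\<^sub>F x in at_bot. norm (exp (\<kappa> * x) * v x) \<le> C * exp (\<kappa> * x)"
          using C by (auto simp: abs_mult mult.commute)
        show "((\<lambda>x. C * exp (\<kappa> * x)) \<longlongrightarrow> 0) at_bot"
          using tendsto_mult_right_zero[OF lim] .
      qed
    qed
  qed
  then show ?thesis by (simp add: zero_le_mult_iff)
qed

text \<open>The same factorization as for existence: \<open>\<kappa> u - u'\<close> is nonnegative by comparison from
  \<open>-\<infinity>\<close>, hence so is \<open>u\<close> by comparison from \<open>+\<infinity>\<close>. Boundedness excludes the growing exponentials.\<close>

lemma helmholtz_comparison: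
  fixes u :: "real \<Rightarrow> real"
  assumes "0 < \<kappa>" and u: "\<And>s. (u has_real_derivative u1 s) (at s)"
    and u1: "\<And>s. (u1 has_real_derivative u2 s) (at s)"
    and le: "\<And>s. u2 s \<le> \<kappa>\<^sup>2 * u s"
    and bd: "bounded (range u)" "bounded (range u1)"
  shows "0 \<le> u s"
proof -
  have bku: "bounded (range (\<lambda>s. \<kappa> * u s))"
    using bounded_scaling[OF bd(1), of \<kappa>] by (simp add: image_image)
  have v: "0 \<le> \<kappa> * u s - u1 s" for s
  proof (rule decay_inequality_nonneg[OF \<open>0 < \<kappa>\<close>, of "\<lambda>s. \<kappa> * u s - u1 s" "\<lambda>s. \<kappa> * u1 s - u2 s"])
    show "((\<lambda>s. \<kappa> * u s - u1 s) has_real_derivative \<kappa> * u1 s - u2 s) (at s)" for s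
      by (auto intro!: derivative_eq_intros u u1)
    show "0 \<le> \<kappa> * u1 s - u2 s + \<kappa> * (\<kappa> * u s - u1 s)" for s
      using le[of s] by (simp add: algebra_simps power2_eq_square)
    show "bounded (range (\<lambda>s. \<kappa> * u s - u1 s))"
      using bounded_minus_comp[OF bku bd(2)] .
  qed
  have "0 \<le> u (- (- s))"
  proof (rule decay_inequality_nonneg[OF \<open>0 < \<kappa>\<close>, of "\<lambda>s. u (- s)" "\<lambda>s. - u1 (- s)" "- s"])
    show "((\<lambda>s. u (- s)) has_real_derivative - u1 (- s)) (at s)" for s
      using u[of "- s"] by (simp add: DERIV_mirror)
    show "0 \<le> - u1 (- s) + \<kappa> * u (- s)" for s using v[of "- s"] by simp
    show "bounded (range (\<lambda>s. u (- s)))"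
      using bd(1) by (rule bounded_subset) auto
  qed
  then show ?thesis by simp
qed

text \<open>A bounded supersolution \<open>z\<close> for the modulus of the forcing dominates both \<open>u\<close> and \<open>- u\<close>.\<close>

lemma helmholtz_bound:
  fixes u z :: "real \<Rightarrow> real"
  assumes "0 < \<kappa>" and u: "\<And>s. (u has_real_derivative u1 s) (at s)"
      "\<And>s. (u1 has_real_derivative \<kappa>\<^sup>2 * u s - f s) (at s)" "bounded (range u)" "bounded (range u1)"
    and z: "\<And>s. (z has_real_derivative z1 s) (at s)"
      "\<And>s. (z1 has_real_derivative z2 s) (at s)" "bounded (range z)" "bounded (range z1)"
    and le: "\<And>s. \<bar>f s\<bar> \<le> \<kappa>\<^sup>2 * z s - z2 s"
  shows "\<bar>u s\<bar> \<le> z s"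
proof -
  have "0 \<le> z s - u s"
  proof (rule helmholtz_comparison[OF \<open>0 < \<kappa>\<close>, of "\<lambda>s. z s - u s" "\<lambda>s. z1 s - u1 s" "\<lambda>s. z2 s - (\<kappa>\<^sup>2 * u s - f s)"])
    show "z2 s - (\<kappa>\<^sup>2 * u s - f s) \<le> \<kappa>\<^sup>2 * (z s - u s)" for s
      using le[of s] by (simp add: algebra_simps)
  qed (auto intro!: derivative_intros u z bounded_minus_comp)
  moreover have "0 \<le> z s + u s"
  proof (rule helmholtz_comparison[OF \<open>0 < \<kappa>\<close>, of "\<lambda>s. z s + u s" "\<lambda>s. z1 s + u1 s" "\<lambda>s. z2 s + (\<kappa>\<^sup>2 * u s - f s)"])
    show "z2 s + (\<kappa>\<^sup>2 * u s - f s) \<le> \<kappa>\<^sup>2 * (z s + u s)" for s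
      using le[of s] by (simp add: algebra_simps)
  qed (auto intro!: derivative_intros u z bounded_plus_comp)
  ultimately show ?thesis by linarith
qed

text \<open>Here \<open>p\<close> is a positive solution of the homogeneous equation for \<open>\<omega> = 0\<close>. With a large constant
  \<open>\<Lambda>\<close>, the equation reads \<open>- r'' + \<Lambda> r = p h + (\<Lambda> - \<omega> - V) r\<close>, with a nonnegative coefficient on the right.
  Writing \<open>r = p w\<close> and inverting the left-hand side gives a map of bounded continuous functions
  \<open>w\<close>. Its linear part is a contraction by comparison with multiples of \<open>p\<close>: since
  \<open>- p'' + \<Lambda> p = (\<Lambda> - V) p\<close> and \<open>\<Lambda> - V \<le> 2 \<Lambda>\<close>, the factor \<open>1 - \<omega> / (2 \<Lambda>)\<close> suffices.\<close>

lemma schroedinger_resolvent: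
  fixes p V h :: "real \<Rightarrow> real"
  assumes pos: "\<And>s. 0 < p s" and p: "\<And>s. (p has_real_derivative p1 s) (at s)"
    and p1: "\<And>s. (p1 has_real_derivative V s * p s) (at s)"
    and bp: "bounded (range p)" "bounded (range p1)"
    and V: "continuous_on UNIV V" "bounded (range V)"
    and h: "continuous_on UNIV h" "bounded (range h)"
    and "0 < \<omega>"
  obtains r r1 where "\<And>s. (r has_real_derivative r1 s) (at s)"
    "\<And>s. (r1 has_real_derivative (\<omega> + V s) * r s - p s * h s) (at s)" "bounded (range r)"
proof -
  obtain B where B: "\<And>s. \<bar>V s\<bar> \<le> B" using V(2) by (auto simp: bounded_iff)
  then have "0 \<le> B" using abs_ge_zero order_trans by blast
  define \<Lambda> where "\<Lambda> = B + \<omega> + 1"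
  define \<kappa> where "\<kappa> = sqrt \<Lambda>"
  have "0 < \<Lambda>" using \<open>0 \<le> B\<close> \<open>0 < \<omega>\<close> by (simp add: \<Lambda>_def)
  then have "0 < \<kappa>" and \<kappa>2: "\<kappa>\<^sup>2 = \<Lambda>" by (auto simp: \<kappa>_def)
  have contp: "continuous_on UNIV p"
    using p by (meson DERIV_isCont continuous_at_imp_continuous_on)
  obtain Ch where Ch: "\<And>s. \<bar>h s\<bar> \<le> Ch" using h(2) by (auto simp: bounded_iff)
  then have "0 \<le> Ch" using abs_ge_zero order_trans by blast
  define rhs :: "(real \<Rightarrow>\<^sub>C real) \<Rightarrow> real \<Rightarrow> real"
    where "rhs w s = p s * h s + (\<Lambda> - \<omega> - V s) * (p s * w s)" for w s
  have coef: "0 \<le> \<Lambda> - \<omega> - V s" "\<Lambda> - V s \<le> 2 * \<Lambda>" "1 \<le> \<Lambda> - V s" for s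
    using B[of s] \<open>0 < \<omega>\<close> by (auto simp: \<Lambda>_def abs_le_iff)
  have bound_rhs: "\<exists>C\<ge>0. \<forall>s. \<bar>rhs w s\<bar> \<le> C * p s" for w
  proof -
    have nw: "\<bar>w s\<bar> \<le> norm w" for s using norm_bounded[of w s] by simp
    show ?thesis
    proof (intro exI[of _ "Ch + 2 * \<Lambda> * norm w"] conjI allI)
      fix s
      have "\<bar>rhs w s\<bar> \<le> p s * \<bar>h s\<bar> + (\<Lambda> - \<omega> - V s) * (p s * \<bar>w s\<bar>)"
        unfolding rhs_def using coef(1)[of s] pos[of s] by (auto simp: abs_mult intro: order_trans[OF abs_triangle_ineq])
      also have "\<dots> \<le> p s * Ch + (2 * \<Lambda>) * (p s * norm w)"
        using coef[of s] pos[of s] nw[of s] Ch[of s] \<open>0 < \<omega>\<close>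
        by (intro add_mono mult_mono) (auto simp: less_imp_le)
      finally show "\<bar>rhs w s\<bar> \<le> (Ch + 2 * \<Lambda> * norm w) * p s" by (simp add: algebra_simps)
    qed (use \<open>0 \<le> Ch\<close> \<open>0 < \<Lambda>\<close> in auto)
  qed
  have cont_rhs: "continuous_on UNIV (rhs w)" for w
    unfolding rhs_def by (intro continuous_intros V h contp) auto
  obtain P where P: "\<And>s. \<bar>p s\<bar> \<le> P" using bp(1) by (auto simp: bounded_iff)
  have bdd_rhs: "bounded (range (rhs w))" for w
  proof -
    obtain C where "0 \<le> C" "\<And>s. \<bar>rhs w s\<bar> \<le> C * p s" using bound_rhs by blast
    moreover have "C * p s \<le> C * P" for s
      using P[of s] \<open>0 \<le> C\<close> by (intro mult_left_mono) auto
    ultimately show ?thesis unfolding bounded_iff by (auto intro: order_trans)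
  qed
  define sol where "sol w u u1 \<longleftrightarrow> (\<forall>s. (u has_real_derivative u1 s) (at s)) \<and>
    (\<forall>s. (u1 has_real_derivative \<kappa>\<^sup>2 * u s - rhs w s) (at s)) \<and> bounded (range u) \<and> bounded (range u1)"
    for w u u1
  have "\<exists>u u1. sol w u u1" for w
    unfolding sol_def using helmholtz_equation_solvable[OF \<open>0 < \<kappa>\<close> cont_rhs bdd_rhs] by metis
  then obtain u u1 where sol: "\<And>w. sol w (u w) (u1 w)" by metis
  have scaled: "((\<lambda>s. c * p s) has_real_derivative c * p1 s) (at s)"
    "((\<lambda>s. c * p1 s) has_real_derivative c * (V s * p s)) (at s)"
    "bounded (range (\<lambda>s. c * p s))" "bounded (range (\<lambda>s. c * p1 s))" for c s
    using bounded_scaling[OF bp(1), of c] bounded_scaling[OF bp(2), of c]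
    by (auto intro!: derivative_eq_intros p p1 simp: image_image)
  have ubound: "\<exists>C. \<forall>s. \<bar>u w s\<bar> \<le> C * p s" for w
  proof -
    obtain C where C: "0 \<le> C" "\<And>s. \<bar>rhs w s\<bar> \<le> C * p s" using bound_rhs by blast
    have "\<bar>u w s\<bar> \<le> C * p s" for s
    proof (rule helmholtz_bound[OF \<open>0 < \<kappa>\<close>, where f = "rhs w" and u = "u w" and ?u1.0 = "u1 w"
            and ?z1.0 = "\<lambda>s. C * p1 s" and ?z2.0 = "\<lambda>s. C * (V s * p s)"])
      fix s
      have "C * p s * 1 \<le> C * p s * (\<Lambda> - V s)"
        using coef(3)[of s] C(1) pos[of s] by (intro mult_left_mono) auto
      then show "\<bar>rhs w s\<bar> \<le> \<kappa>\<^sup>2 * (C * p s) - C * (V s * p s)"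
        using C(2)[of s] by (simp add: \<kappa>2 algebra_simps)
    qed (use sol[of w] scaled in \<open>auto simp: sol_def\<close>)
    then show ?thesis by blast
  qed
  define T where "T w = Bcontfun (\<lambda>s. u w s / p s)" for w
  have T: "T w s = u w s / p s" for w s
  proof -
    obtain C where C: "\<And>s. \<bar>u w s\<bar> \<le> C * p s" using ubound by blast
    have "continuous_on UNIV (u w)"
      using sol[of w] unfolding sol_def by (meson DERIV_isCont continuous_at_imp_continuous_on)
    moreover have "p s \<noteq> 0" for s using pos[of s] by simp
    ultimately have "(\<lambda>s. u w s / p s) \<in> bcontfun"
      using C pos by (intro bcontfun_normI[where b = C] continuous_intros contp)
        (auto simp: abs_div pos_divide_le_eq abs_of_pos[OF pos])
    then show ?thesis by (simp add: T_def Bcontfun_inverse)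
  qed
  define \<gamma> where "\<gamma> = 1 - \<omega> / (2 * \<Lambda>)"
  have "\<omega> \<le> \<Lambda>" using \<open>0 \<le> B\<close> by (simp add: \<Lambda>_def)
  then have \<gamma>: "0 \<le> \<gamma>" "\<gamma> < 1" using \<open>0 < \<Lambda>\<close> \<open>0 < \<omega>\<close> by (auto simp: \<gamma>_def)
  have "dist (T w) (T w') \<le> \<gamma> * dist w w'" for w w'
  proof (rule dist_bound)
    fix s
    define D where "D = dist w w'"
    have D: "\<bar>w s - w' s\<bar> \<le> D" for s
      using dist_bounded[of w s w'] by (simp add: D_def dist_real_def)
    have "0 \<le> D" by (simp add: D_def)
    have "\<bar>u w s - u w' s\<bar> \<le> \<gamma> * D * p s"
    proof (rule helmholtz_bound[OF \<open>0 < \<kappa>\<close>, where f = "\<lambda>s. rhs w s - rhs w' s"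
            and u = "\<lambda>s. u w s - u w' s" and ?u1.0 = "\<lambda>s. u1 w s - u1 w' s"
            and ?z1.0 = "\<lambda>s. \<gamma> * D * p1 s" and ?z2.0 = "\<lambda>s. \<gamma> * D * (V s * p s)"])
      fix s
      have "\<bar>rhs w s - rhs w' s\<bar> = (\<Lambda> - \<omega> - V s) * (p s * \<bar>w s - w' s\<bar>)"
        using coef(1)[of s] pos[of s] by (simp add: rhs_def abs_mult flip: right_diff_distrib)
      also have "\<dots> \<le> (\<Lambda> - \<omega> - V s) * (p s * D)"
        using coef(1)[of s] pos[of s] D by (intro mult_left_mono) auto
      also have "\<dots> \<le> \<gamma> * (\<Lambda> - V s) * (p s * D)"
      proof (rule mult_right_mono)
        have "\<omega> / (2 * \<Lambda>) * (\<Lambda> - V s) \<le> \<omega> / (2 * \<Lambda>) * (2 * \<Lambda>)"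
          using coef(2)[of s] \<open>0 < \<Lambda>\<close> \<open>0 < \<omega>\<close> by (intro mult_left_mono) auto
        also have "\<dots> = \<omega>" using \<open>0 < \<Lambda>\<close> by simp
        finally have "\<omega> / (2 * \<Lambda>) * (\<Lambda> - V s) \<le> \<omega>" .
        moreover have "\<gamma> * (\<Lambda> - V s) = (\<Lambda> - V s) - \<omega> / (2 * \<Lambda>) * (\<Lambda> - V s)"
          by (simp only: \<gamma>_def left_diff_distrib mult_1_left)
        ultimately show "\<Lambda> - \<omega> - V s \<le> \<gamma> * (\<Lambda> - V s)" by linarith
      qed (use \<open>0 \<le> D\<close> pos[of s] in auto)
      finally show "\<bar>rhs w s - rhs w' s\<bar> \<le> \<kappa>\<^sup>2 * (\<gamma> * D * p s) - \<gamma> * D * (V s * p s)"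
        by (simp add: \<kappa>2 algebra_simps)
    next
      show "((\<lambda>s. u1 w s - u1 w' s) has_real_derivative \<kappa>\<^sup>2 * (u w s - u w' s) - (rhs w s - rhs w' s)) (at s)" for s
        using sol[of w] sol[of w'] by (auto simp: sol_def algebra_simps intro!: derivative_eq_intros)
    qed (use sol[of w] sol[of w'] scaled[of "\<gamma> * D"] in
        \<open>auto simp: sol_def intro!: derivative_eq_intros bounded_minus_comp\<close>)
    then show "dist (T w s) (T w' s) \<le> \<gamma> * dist w w'"
      using pos[of s] by (simp add: T dist_real_def D_def abs_div pos_divide_le_eq flip: diff_divide_distrib)
  qed
  then obtain w where w: "T w = w" using banach_fix_type[OF \<gamma>, of T] by blast
  have uw: "p s * w s = u w s" for s
    using T[of w s] w pos[of s] by simp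
  show ?thesis
  proof
    show "(u w has_real_derivative u1 w s) (at s)" "bounded (range (u w))" for s
      using sol[of w] by (auto simp: sol_def)
    have "\<kappa>\<^sup>2 * u w s - rhs w s = (\<omega> + V s) * u w s - p s * h s" for s
      by (simp add: rhs_def uw \<kappa>2 algebra_simps)
    then show "(u1 w has_real_derivative (\<omega> + V s) * u w s - p s * h s) (at s)" for s
      using sol[of w] by (auto simp: sol_def)
  qed
qed

section \<open>Bounded Lipschitz functions\<close>

definition bounded_lipschitz :: "('a::metric_space \<Rightarrow> real) \<Rightarrow> bool" where
  "bounded_lipschitz f \<longleftrightarrow> bounded (range f) \<and> (\<exists>L. L-lipschitz_on UNIV f)"

lemma bounded_lipschitz_obtain:
  assumes "bounded_lipschitz f"
  obtains B L where "0 \<le> B" "0 \<le> L" "\<And>x. \<bar>f x\<bar> \<le> B" "\<And>x y. \<bar>f x - f y\<bar> \<le> L * dist x y"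
proof -
  obtain B where B: "\<And>x. \<bar>f x\<bar> \<le> B"
    using assms by (auto simp: bounded_lipschitz_def bounded_iff)
  obtain L where "L-lipschitz_on UNIV f"
    using assms by (auto simp: bounded_lipschitz_def)
  then have "0 \<le> L" "\<And>x y. \<bar>f x - f y\<bar> \<le> L * dist x y"
    by (auto simp: lipschitz_on_def dist_real_def)
  moreover have "0 \<le> B" using B abs_ge_zero order_trans by blast
  ultimately show ?thesis using that B by blast
qed

lemma bounded_lipschitzI:
  assumes "0 \<le> L" "\<And>x. \<bar>f x\<bar> \<le> B" "\<And>x y. \<bar>f x - f y\<bar> \<le> L * dist x y"
  shows "bounded_lipschitz f"
  using assms unfolding bounded_lipschitz_def lipschitz_on_def bounded_iff dist_real_def by auto

lemma bounded_lipschitz_imp_continuous: "bounded_lipschitz f \<Longrightarrow> continuous_on UNIV f"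
  unfolding bounded_lipschitz_def using lipschitz_on_continuous_on by blast

lemma bounded_lipschitz_imp_bounded: "bounded_lipschitz f \<Longrightarrow> bounded (range f)"
  unfolding bounded_lipschitz_def by blast

named_theorems bounded_lipschitz_intros

lemma bounded_lipschitz_const [bounded_lipschitz_intros]: "bounded_lipschitz (\<lambda>x. c)"
  by (rule bounded_lipschitzI[of 0 _ "\<bar>c\<bar>"]) auto

lemma bounded_lipschitz_add [bounded_lipschitz_intros]:
  assumes "bounded_lipschitz f" "bounded_lipschitz g"
  shows "bounded_lipschitz (\<lambda>x. f x + g x)"
  using assms lipschitz_on_add unfolding bounded_lipschitz_def by (blast intro: bounded_plus_comp)

lemma bounded_lipschitz_mult [bounded_lipschitz_intros]:
  assumes "bounded_lipschitz f" "bounded_lipschitz g"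
  shows "bounded_lipschitz (\<lambda>x. f x * g x)"
proof -
  obtain B L where f: "0 \<le> B" "0 \<le> L" "\<And>x. \<bar>f x\<bar> \<le> B" "\<And>x y. \<bar>f x - f y\<bar> \<le> L * dist x y"
    using bounded_lipschitz_obtain[OF assms(1)] by blast
  obtain C M where g: "0 \<le> C" "0 \<le> M" "\<And>x. \<bar>g x\<bar> \<le> C" "\<And>x y. \<bar>g x - g y\<bar> \<le> M * dist x y"
    using bounded_lipschitz_obtain[OF assms(2)] by blast
  show ?thesis
  proof (rule bounded_lipschitzI)
    show "\<bar>f x * g x\<bar> \<le> B * C" for x
      unfolding abs_mult by (intro mult_mono f g) auto
    show "\<bar>f x * g x - f y * g y\<bar> \<le> (B * M + L * C) * dist x y" for x y
    proof -
      have "f x * g x - f y * g y = f x * (g x - g y) + (f x - f y) * g y"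
        by (simp add: algebra_simps)
      also have "\<bar>\<dots>\<bar> \<le> \<bar>f x\<bar> * \<bar>g x - g y\<bar> + \<bar>f x - f y\<bar> * \<bar>g y\<bar>"
        by (metis abs_mult abs_triangle_ineq)
      also have "\<dots> \<le> B * (M * dist x y) + (L * dist x y) * C"
        by (intro add_mono mult_mono f g) (use f g in auto)
      finally show ?thesis by (simp add: algebra_simps)
    qed
  qed (use f g in auto)
qed

lemma bounded_lipschitz_minus [bounded_lipschitz_intros]:
  assumes "bounded_lipschitz f"
  shows "bounded_lipschitz (\<lambda>x. - f x)"
  using bounded_lipschitz_mult[OF bounded_lipschitz_const[of "-1"] assms] by simp

lemma bounded_lipschitz_diff [bounded_lipschitz_intros]:
  assumes "bounded_lipschitz f" "bounded_lipschitz g"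
  shows "bounded_lipschitz (\<lambda>x. f x - g x)"
  using bounded_lipschitz_add[OF assms(1) bounded_lipschitz_minus[OF assms(2)]] by simp

lemma bounded_lipschitz_power [bounded_lipschitz_intros]:
  "bounded_lipschitz f \<Longrightarrow> bounded_lipschitz (\<lambda>x. f x ^ n)"
  by (induction n) (auto intro: bounded_lipschitz_intros)

lemma bounded_lipschitz_of_deriv:
  fixes f :: "real \<Rightarrow> real"
  assumes f: "\<And>x. (f has_real_derivative f' x) (at x)" and bd: "bounded (range f)" "bounded (range f')"
  shows "bounded_lipschitz f"
proof -
  obtain L where L: "\<And>x. \<bar>f' x\<bar> \<le> L" using bd(2) by (auto simp: bounded_iff)
  obtain B where B: "\<And>x. \<bar>f x\<bar> \<le> B" using bd(1) by (auto simp: bounded_iff)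
  show ?thesis
  proof (rule bounded_lipschitzI[OF _ B])
    show "0 \<le> L" using L abs_ge_zero order_trans by blast
    show "\<bar>f x - f y\<bar> \<le> L * dist x y" for x y
      using field_differentiable_bound[of UNIV f f' L x y] f L by (auto simp: dist_norm)
  qed
qed

text \<open>A qualitative Landau inequality: on each unit interval the derivative takes the value of a
  difference quotient of \<open>r\<close>, and it varies by at most \<open>sup |r2|\<close> there.\<close>

lemma bounded_first_derivative:
  fixes r :: "real \<Rightarrow> real"
  assumes r: "\<And>x. (r has_real_derivative r1 x) (at x)" and r1: "\<And>x. (r1 has_real_derivative r2 x) (at x)"
    and bd: "bounded (range r)" "bounded (range r2)"
  shows "bounded (range r1)"
proof -
  obtain B where B: "\<And>x. \<bar>r x\<bar> \<le> B" using bd(1) by (auto simp: bounded_iff)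
  obtain C where C: "\<And>x. \<bar>r2 x\<bar> \<le> C" using bd(2) by (auto simp: bounded_iff)
  have "\<bar>r1 s\<bar> \<le> 2 * B + C" for s
  proof -
    obtain t where t: "s < t" "t < s + 1" "r (s + 1) - r s = (s + 1 - s) * r1 t"
      using MVT2[of s "s + 1" r r1] r by auto
    have "\<bar>r1 s - r1 t\<bar> \<le> C * \<bar>s - t\<bar>"
      using field_differentiable_bound[of UNIV r1 r2 C s t] r1 C by auto
    also have "\<dots> \<le> C * 1"
      using t C[of 0] by (intro mult_left_mono) auto
    finally show ?thesis using t B[of s] B[of "s + 1"] by auto
  qed
  then show ?thesis by (auto simp: bounded_iff)
qed

definition c2_lipschitz :: "(real \<Rightarrow> real) \<Rightarrow> (real \<Rightarrow> real) \<Rightarrow> (real \<Rightarrow> real) \<Rightarrow> bool" where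
  "c2_lipschitz r r1 r2 \<longleftrightarrow> (\<forall>s. (r has_real_derivative r1 s) (at s)) \<and>
    (\<forall>s. (r1 has_real_derivative r2 s) (at s)) \<and>
    bounded_lipschitz r \<and> bounded_lipschitz r1 \<and> bounded_lipschitz r2"

text \<open>The equation bounds the second derivative by \<open>r\<close> itself, interpolation then bounds the first one,
  and the equation once more shows that the second derivative is Lipschitz.\<close>

lemma bounded_solution_imp_c2_lipschitz:
  fixes r :: "real \<Rightarrow> real"
  assumes r: "\<And>s. (r has_real_derivative r1 s) (at s)"
    and r1: "\<And>s. (r1 has_real_derivative c s * r s - f s) (at s)"
    and bd: "bounded (range r)" and c: "bounded_lipschitz c" and f: "bounded_lipschitz f"
  shows "c2_lipschitz r r1 (\<lambda>s. c s * r s - f s)"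
proof -
  obtain B where B: "\<And>x. \<bar>r x\<bar> \<le> B" using bd by (auto simp: bounded_iff)
  obtain C where C: "\<And>x. \<bar>c x\<bar> \<le> C" using c by (auto simp: bounded_lipschitz_def bounded_iff)
  obtain D where D: "\<And>x. \<bar>f x\<bar> \<le> D" using f by (auto simp: bounded_lipschitz_def bounded_iff)
  have "0 \<le> C" using C abs_ge_zero order_trans by blast
  have "\<bar>c s * r s\<bar> \<le> C * B" for s
    unfolding abs_mult by (intro mult_mono B C) (use \<open>0 \<le> C\<close> in auto)
  then have "\<bar>c s * r s - f s\<bar> \<le> C * B + D" for s
    using D by (meson abs_triangle_ineq4 add_mono order_trans)
  then have b2: "bounded (range (\<lambda>s. c s * r s - f s))" by (auto simp: bounded_iff)
  have b1: "bounded (range r1)" using bounded_first_derivative[OF r r1 bd b2] .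
  have "bounded_lipschitz r" using bounded_lipschitz_of_deriv[OF r bd b1] .
  moreover have "bounded_lipschitz r1" using bounded_lipschitz_of_deriv[OF r1 b1 b2] .
  ultimately show ?thesis
    unfolding c2_lipschitz_def using r r1 by (auto intro!: bounded_lipschitz_intros c f)
qed

section \<open>Quadratic growth at a nondegenerate minimum\<close>

text \<open>Near \<open>0\<close> the expansion of \<open>f1\<close> gives \<open>f x \<ge> a x\<^sup>2 / 4\<close>; away from \<open>0\<close> the positive minimum
  of \<open>f\<close> on a compact interval does.\<close>

lemma quadratic_growth:
  fixes f f1 :: "real \<Rightarrow> real"
  assumes f: "\<And>x. x \<in> {0..1} \<Longrightarrow> (f has_real_derivative f1 x) (at x within {0..1})"
    and f1: "(f1 has_real_derivative a) (at 0 within {0..1})"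
    and zero: "f 0 = 0" "f1 0 = 0" and "0 < a" and pos: "\<And>x. x \<in> {0<..1} \<Longrightarrow> 0 < f x"
  obtains c where "0 < c" "\<And>x. x \<in> {0..1} \<Longrightarrow> c * x\<^sup>2 \<le> f x"
proof -
  have "((\<lambda>x. f1 x / x) \<longlongrightarrow> a) (at 0 within {0..1})"
    using f1 zero by (simp add: has_field_derivative_iff)
  then have "\<forall>\<^sub>F x in at 0 within {0..1}. a / 2 < f1 x / x"
    using \<open>0 < a\<close> by (intro order_tendstoD) auto
  then obtain \<delta> where \<delta>: "0 < \<delta>" "\<And>x. x \<in> {0..1} \<Longrightarrow> x \<noteq> 0 \<Longrightarrow> \<bar>x\<bar> < \<delta> \<Longrightarrow> a / 2 < f1 x / x"
    by (auto simp: eventually_at dist_real_def)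
  have cont: "continuous_on {0..1} f"
    using f by (meson DERIV_continuous_on)
  have near: "a / 4 * x\<^sup>2 \<le> f x" if x: "0 \<le> x" "x \<le> 1" "x < \<delta>" for x
  proof -
    have "f 0 - a / 4 * 0\<^sup>2 \<le> f x - a / 4 * x\<^sup>2"
    proof (rule DERIV_nonneg_imp_increasing_open[OF x(1)])
      fix y assume y: "0 < y" "y < x"
      have "(f has_real_derivative f1 y) (at y)"
        using f[of y] y x at_within_Icc_at[of 0 y 1] by simp
      then have "((\<lambda>x. f x - a / 4 * x\<^sup>2) has_real_derivative f1 y - a / 2 * y) (at y)"
        by (auto intro!: derivative_eq_intros)
      moreover have "0 \<le> f1 y - a / 2 * y"
        using \<delta>(2)[of y] x y by (simp add: field_simps)
      ultimately show "\<exists>z. ((\<lambda>x. f x - a / 4 * x\<^sup>2) has_real_derivative z) (at y) \<and> 0 \<le> z" by blast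
    next
      show "continuous_on {0..x} (\<lambda>x. f x - a / 4 * x\<^sup>2)"
        using x by (intro continuous_intros continuous_on_subset[OF cont]) auto
    qed
    then show ?thesis using zero by simp
  qed
  define d where "d = min \<delta> 1 / 2"
  have d: "0 < d" "d < 1" "d < \<delta>" using \<delta>(1) by (auto simp: d_def)
  have "compact {d..1}" "{d..1} \<noteq> {}" "continuous_on {d..1} f"
    using d by (auto intro: continuous_on_subset[OF cont])
  from continuous_attains_inf[OF this]
  obtain z where z: "z \<in> {d..1}" "\<And>x. x \<in> {d..1} \<Longrightarrow> f z \<le> f x" by blast
  have "0 < f z" using z d by (intro pos) auto
  show ?thesis
  proof (rule that[of "min (a / 4) (f z)"])
    fix x :: real assume x: "x \<in> {0..1}"
    show "min (a / 4) (f z) * x\<^sup>2 \<le> f x"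
    proof (cases "x < \<delta>")
      case True
      have "min (a / 4) (f z) * x\<^sup>2 \<le> a / 4 * x\<^sup>2" by (intro mult_right_mono) auto
      then show ?thesis using near[of x] x True by auto
    next
      case False
      have "min (a / 4) (f z) * x\<^sup>2 \<le> f z * 1"
        using x \<open>0 < f z\<close> by (intro mult_mono) (auto simp: power_le_one)
      then show ?thesis using z(2)[of x] x False d by auto
    qed
  qed (use \<open>0 < a\<close> \<open>0 < f z\<close> in auto)
qed

section \<open>The standing wave and its linearization\<close>

locale allen_cahn_wave =
  fixes W q :: "real \<Rightarrow> real"
  assumes well: "double_well W" and wave: "standing_wave W q"
begin

abbreviation "W1 \<equiv> icc_deriv W"
abbreviation "W2 \<equiv> icc_deriv W1"
abbreviation "W3 \<equiv> icc_deriv W2"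

lemma icc_has_deriv:
  assumes "f differentiable_on {-1..1}" "x \<in> {-1..1}"
  shows "(f has_real_derivative icc_deriv f x) (at x within {-1..1})"
  using assms unfolding icc_deriv_def has_real_derivative_iff_has_vector_derivative
  by (simp add: differentiable_on_def vector_derivative_works)

lemma well_smooth: "W differentiable_on {-1..1}" "W1 differentiable_on {-1..1}"
  "W2 differentiable_on {-1..1}" "continuous_on {-1..1} W3"
proof -
  have d: "(icc_deriv ^^ j) W differentiable_on {-1..1}" if "j < 3" for j
    using well that by (auto simp: double_well_def)
  show "W differentiable_on {-1..1}" "W1 differentiable_on {-1..1}" "W2 differentiable_on {-1..1}"
    using d[of 0] d[of 1] d[of 2] by (simp_all add: numeral_2_eq_2)
  show "continuous_on {-1..1} W3"
    using well by (simp add: double_well_def numeral_3_eq_3)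
qed

lemma well_zeros: "W (-1) = 0" "W 1 = 0" "W1 (-1) = 0" "W1 1 = 0"
proof -
  have "{x\<in>{-1..1}. W x = 0} = {-1, 1}" "{x\<in>{-1..1}. W1 x = 0} = {-1, 0, 1}"
    using well by (simp_all add: double_well_def)
  then have "-1 \<in> {x\<in>{-1..1}. W x = 0}" "1 \<in> {x\<in>{-1..1}. W x = 0}"
    "-1 \<in> {x\<in>{-1..1}. W1 x = 0}" "1 \<in> {x\<in>{-1..1}. W1 x = 0}"
    by simp_all
  then show "W (-1) = 0" "W 1 = 0" "W1 (-1) = 0" "W1 1 = 0" by simp_all
qed

lemma well_pos: "-1 < x \<Longrightarrow> x < 1 \<Longrightarrow> 0 < W x"
proof -
  assume x: "-1 < x" "x < 1"
  have "{x\<in>{-1..1}. W x = 0} = {-1, 1}" "\<forall>x\<in>{-1..1}. 0 \<le> W x"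
    using well by (simp_all add: double_well_def)
  moreover have "x \<notin> {-1, 1}" "x \<in> {-1..1}" using x by auto
  ultimately have "W x \<noteq> 0" "0 \<le> W x" by blast+
  then show ?thesis by simp
qed

lemma q_range: "-1 < q s" "q s < 1"
proof -
  have "range q \<subseteq> {-1<..<1}" using wave by (simp add: standing_wave_def)
  then have "q s \<in> {-1<..<1}" by blast
  then show "-1 < q s" "q s < 1" by simp_all
qed

lemma q_mem: "q s \<in> {-1..1}"
  using q_range[of s] by simp

lemma q_strict_mono: "s < t \<Longrightarrow> q s < q t"
  using wave by (auto simp: standing_wave_def strict_mono_def)

lemma q_zero: "q 0 = 0" and q_top: "(q \<longlongrightarrow> 1) at_top" and q_bot: "(q \<longlongrightarrow> -1) at_bot"
  using wave by (auto simp: standing_wave_def)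

lemma q_deriv: "(q has_real_derivative deriv q s) (at s)"
  using wave by (simp add: standing_wave_def DERIV_deriv_iff_real_differentiable)

lemma velocity_deriv: "(deriv q has_real_derivative W1 (q s)) (at s)"
proof -
  have "(deriv q has_real_derivative deriv (deriv q) s) (at s)"
    using wave by (simp add: standing_wave_def DERIV_deriv_iff_real_differentiable)
  moreover have "deriv (deriv q) s = W1 (q s)" using wave by (simp add: standing_wave_def)
  ultimately show ?thesis by simp
qed

lemma along_wave_deriv:
  assumes "f differentiable_on {-1..1}"
  shows "((\<lambda>s. f (q s)) has_real_derivative icc_deriv f (q s) * deriv q s) (at s)"
proof -
  have "(f has_real_derivative icc_deriv f (q s)) (at (q s))"
    using icc_has_deriv[OF assms q_mem[of s]] at_within_Icc_at[of "-1" "q s" 1] q_range[of s] by simp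
  then show ?thesis by (rule DERIV_chain2[OF _ q_deriv])
qed

lemma along_wave_bounded:
  assumes "continuous_on {-1..1} f"
  shows "bounded (range (\<lambda>s. f (q s)))"
  by (rule bounded_subset[OF compact_imp_bounded[OF compact_continuous_image[OF assms compact_Icc]]])
    (use q_mem in auto)

lemmas well_continuous = well_smooth(1-3)[THEN differentiable_imp_continuous_on]

text \<open>The energy \<open>q'\<^sup>2 / 2 - W(q)\<close> is constant. By the mean value theorem on \<open>[n, n+1]\<close> and the
  convergence of \<open>q\<close>, the velocity is arbitrarily small at arbitrarily late times, where \<open>W(q)\<close> is
  small as well; so the constant is \<open>0\<close>.\<close>

lemma energy: "(deriv q s)\<^sup>2 = 2 * W (q s)"
proof -
  define E where "E s = (deriv q s)\<^sup>2 / 2 - W (q s)" for s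
  have "(E has_real_derivative 0) (at s)" for s
    unfolding E_def
    by (auto intro!: derivative_eq_intros velocity_deriv along_wave_deriv[OF well_smooth(1)])
  then have const: "E s = E 0" for s using DERIV_isconst_all by blast
  \<comment> \<open>The velocity at these intermediate points is an increment of \<open>q\<close> over a unit interval.\<close>
  obtain \<xi> where \<xi>: "\<And>n::nat. real n < \<xi> n \<and> q (real n + 1) - q (real n) = deriv q (\<xi> n)"
  proof -
    have "\<exists>t. real n < t \<and> q (real n + 1) - q (real n) = deriv q t" for n
      using MVT2[of "real n" "real n + 1" q "deriv q"] q_deriv by fastforce
    then show ?thesis using that by metis
  qed
  have "filterlim (\<lambda>n. real n + 1) at_top sequentially"
    by (rule filterlim_at_top_mono[OF filterlim_real_sequentially]) simp
  then have "(\<lambda>n. q (real n + 1) - q (real n)) \<longlonglongrightarrow> 1 - 1"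
    by (intro tendsto_diff filterlim_compose[OF q_top] filterlim_real_sequentially)
  then have vel: "(\<lambda>n. deriv q (\<xi> n)) \<longlonglongrightarrow> 0" using \<xi> by simp
  have "filterlim \<xi> at_top sequentially"
    by (rule filterlim_at_top_mono[OF filterlim_real_sequentially]) (use \<xi> in \<open>auto intro!: always_eventually less_imp_le\<close>)
  then have "(\<lambda>n. q (\<xi> n)) \<longlonglongrightarrow> 1" by (rule filterlim_compose[OF q_top])
  then have "(\<lambda>n. W (q (\<xi> n))) \<longlonglongrightarrow> W 1"
    by (rule continuous_on_tendsto_compose[OF well_continuous(1)]) (use q_mem in auto)
  then have "(\<lambda>n. E (\<xi> n)) \<longlonglongrightarrow> 0\<^sup>2 / 2 - W 1"
    unfolding E_def by (intro tendsto_diff tendsto_divide tendsto_power tendsto_const vel) auto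
  moreover have "(\<lambda>n. E (\<xi> n)) = (\<lambda>n. E 0)" using const by blast
  ultimately have "E 0 = 0" using well_zeros by (simp add: LIMSEQ_const_iff)
  then show ?thesis using const[of s] by (simp add: E_def)
qed

lemma velocity_pos: "0 < deriv q s"
proof -
  have "mono_on UNIV q"
    using q_strict_mono by (metis less_eq_real_def monotone_onI)
  then have "0 \<le> deriv q s"
    using mono_on_imp_deriv_nonneg[of UNIV q "deriv q s" s] q_deriv by simp
  moreover have "deriv q s \<noteq> 0"
    using energy[of s] well_pos[of "q s"] q_range[of s] by auto
  ultimately show ?thesis by simp
qed

lemma velocity_bounded: "bounded (range (deriv q))"
  using q_deriv velocity_deriv
proof (rule bounded_first_derivative)
  show "bounded (range q)" "bounded (range (\<lambda>s. W1 (q s)))"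
    using along_wave_bounded[of "\<lambda>x. x"] along_wave_bounded[of W1] well_continuous by auto
qed

lemma velocity_lipschitz: "bounded_lipschitz (deriv q)"
  using bounded_lipschitz_of_deriv[OF velocity_deriv velocity_bounded] along_wave_bounded[of W1] well_continuous by simp

lemma potential_lipschitz: "bounded_lipschitz (\<lambda>s. W2 (q s))"
proof (rule bounded_lipschitz_of_deriv[OF along_wave_deriv[OF well_smooth(3)]])
  show "bounded (range (\<lambda>s. W2 (q s)))" using along_wave_bounded well_continuous by blast
  obtain B C where B: "\<And>s. \<bar>W3 (q s)\<bar> \<le> B" and C: "\<And>s. \<bar>deriv q s\<bar> \<le> C"
    using along_wave_bounded[OF well_smooth(4)] velocity_bounded by (auto simp: bounded_iff)
  have "0 \<le> B" using B abs_ge_zero order_trans by blast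
  then have "\<bar>W3 (q s) * deriv q s\<bar> \<le> B * C" for s
    unfolding abs_mult by (intro mult_mono B C) auto
  then show "bounded (range (\<lambda>s. W3 (q s) * deriv q s))" by (auto simp: bounded_iff)
qed

lemma velocity_continuous: "continuous_on UNIV (deriv q)"
  using velocity_deriv by (meson DERIV_isCont continuous_at_imp_continuous_on)

lemma velocity_increasing:
  assumes "s \<le> t" "t \<le> 0"
  shows "deriv q s \<le> deriv q t"
proof (rule DERIV_nonneg_imp_increasing_open[OF assms(1)])
  fix x assume "s < x" "x < t"
  with assms have "x < 0" by simp
  then have "q x < 0" using q_strict_mono[of x 0] q_zero by simp
  then have "0 < W1 (q x)" using well q_range[of x] by (auto simp: double_well_def)
  then show "\<exists>y. (deriv q has_real_derivative y) (at x) \<and> 0 \<le> y"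
    using velocity_deriv less_imp_le by blast
qed (rule continuous_on_subset[OF velocity_continuous], simp)

lemma velocity_decreasing:
  assumes "s \<le> t" "0 \<le> s"
  shows "deriv q t \<le> deriv q s"
proof (rule DERIV_nonpos_imp_decreasing_open[OF assms(1)])
  fix x assume "s < x" "x < t"
  with assms have "0 < x" by simp
  then have "0 < q x" using q_strict_mono[of 0 x] q_zero by simp
  then have "W1 (q x) < 0" using well q_range[of x] by (auto simp: double_well_def)
  then show "\<exists>y. (deriv q has_real_derivative y) (at x) \<and> y \<le> 0"
    using velocity_deriv less_imp_le by blast
qed (rule continuous_on_subset[OF velocity_continuous], simp)

text \<open>The velocity is monotone on each half-line, so \<open>|s| q'(s)\<close> is at most the distance that the wave
  travels between \<open>0\<close> and \<open>s\<close>. This absorbs the linear growth that reduction of order produces.\<close>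

lemma velocity_times_position_le: "\<bar>s\<bar> * deriv q s \<le> 1"
proof (cases "s = 0")
  case False
  then consider "0 < s" | "s < 0" by linarith
  then show ?thesis
  proof cases
    case 1
    then obtain t where t: "0 < t" "t < s" "q s - q 0 = (s - 0) * deriv q t"
      using MVT2[of 0 s q "deriv q"] q_deriv by auto
    have "s * deriv q s \<le> s * deriv q t"
      using 1 t velocity_decreasing[of t s] by (intro mult_left_mono) auto
    also have "\<dots> < 1" using t q_zero q_range(2)[of s] by simp
    finally show ?thesis using 1 by simp
  next
    case 2
    then obtain t where t: "s < t" "t < 0" "q 0 - q s = (0 - s) * deriv q t"
      using MVT2[of s 0 q "deriv q"] q_deriv by auto
    have "(- s) * deriv q s \<le> (- s) * deriv q t"
      using 2 t velocity_increasing[of s t] by (intro mult_left_mono) auto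
    also have "\<dots> < 1" using t q_zero q_range(1)[of s] by simp
    finally show ?thesis using 2 by simp
  qed
qed simp

text \<open>By the energy identity \<open>q'\<close> is the square root of \<open>2 W(q)\<close>, and \<open>W\<close> dominates the squared
  distance to its wells.\<close>

lemma distance_to_wells_le_velocity: obtains C where "0 < C" "\<And>s. 1 - \<bar>q s\<bar> \<le> C * deriv q s"
proof -
  obtain c where c: "0 < c" "\<And>x. x \<in> {0..1} \<Longrightarrow> c * x\<^sup>2 \<le> W (-1 + x)"
  proof (rule quadratic_growth[of "\<lambda>x. W (-1 + x)" "\<lambda>x. W1 (-1 + x)" "W2 (-1)"])
    have sub: "(\<lambda>x. -1 + x) ` {0..1} \<subseteq> {-1..1::real}" by auto
    have ch: "((f \<circ> (\<lambda>x. -1 + x)) has_real_derivative icc_deriv f (-1 + x) * 1) (at x within {0..1})"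
      if "f differentiable_on {-1..1}" "x \<in> {0..1}" for f and x :: real
      by (rule DERIV_image_chain[OF DERIV_subset[OF icc_has_deriv[OF that(1)] sub]])
        (use that in \<open>auto intro!: derivative_eq_intros\<close>)
    show "((\<lambda>x. W (-1 + x)) has_real_derivative W1 (-1 + x)) (at x within {0..1})" if "x \<in> {0..1}" for x
      using ch[OF well_smooth(1) that] by (simp add: o_def)
    show "((\<lambda>x. W1 (-1 + x)) has_real_derivative W2 (-1)) (at 0 within {0..1})"
      using ch[OF well_smooth(2), of 0] by (simp add: o_def)
    show "0 < W2 (-1)" using well by (simp add: double_well_def)
    show "0 < W (-1 + x)" if "x \<in> {0<..1}" for x using that by (intro well_pos) auto
  qed (use well_zeros that in auto)
  obtain d where d: "0 < d" "\<And>x. x \<in> {0..1} \<Longrightarrow> d * x\<^sup>2 \<le> W (1 - x)"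
  proof (rule quadratic_growth[of "\<lambda>x. W (1 - x)" "\<lambda>x. - W1 (1 - x)" "W2 1"])
    have sub: "(\<lambda>x. 1 - x) ` {0..1} \<subseteq> {-1..1::real}" by auto
    have ch: "((f \<circ> (\<lambda>x. 1 - x)) has_real_derivative icc_deriv f (1 - x) * (-1)) (at x within {0..1})"
      if "f differentiable_on {-1..1}" "x \<in> {0..1}" for f and x :: real
      by (rule DERIV_image_chain[OF DERIV_subset[OF icc_has_deriv[OF that(1)] sub]])
        (use that in \<open>auto intro!: derivative_eq_intros\<close>)
    show "((\<lambda>x. W (1 - x)) has_real_derivative - W1 (1 - x)) (at x within {0..1})" if "x \<in> {0..1}" for x
      using ch[OF well_smooth(1) that] by (simp add: o_def)
    show "((\<lambda>x. - W1 (1 - x)) has_real_derivative W2 1) (at 0 within {0..1})"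
      using ch[OF well_smooth(2), of 0] by (auto simp: o_def intro!: derivative_eq_intros)
    show "0 < W2 1" using well by (simp add: double_well_def)
    show "0 < W (1 - x)" if "x \<in> {0<..1}" for x using that by (intro well_pos) auto
  qed (use well_zeros that in auto)
  define b where "b = min c d"
  have "0 < b" using c d by (simp add: b_def)
  have W: "b * (1 - \<bar>x\<bar>)\<^sup>2 \<le> W x" if "-1 < x" "x < 1" for x
  proof (cases "0 \<le> x")
    case True
    have "b * (1 - x)\<^sup>2 \<le> d * (1 - x)\<^sup>2" by (intro mult_right_mono) (auto simp: b_def)
    also have "\<dots> \<le> W x" using d(2)[of "1 - x"] True that by simp
    finally show ?thesis using True by simp
  next
    case False
    have "b * (1 + x)\<^sup>2 \<le> c * (1 + x)\<^sup>2" by (intro mult_right_mono) (auto simp: b_def)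
    also have "\<dots> \<le> W x" using c(2)[of "1 + x"] False that by simp
    finally show ?thesis using False by simp
  qed
  show ?thesis
  proof (rule that[of "1 / sqrt (2 * b)"])
    fix s
    have "(sqrt (2 * b) * (1 - \<bar>q s\<bar>))\<^sup>2 \<le> (deriv q s)\<^sup>2"
      using W[of "q s"] q_range[of s] \<open>0 < b\<close> by (simp add: energy power_mult_distrib)
    then have "sqrt (2 * b) * (1 - \<bar>q s\<bar>) \<le> deriv q s"
      by (rule power2_le_imp_le) (simp add: velocity_pos less_imp_le)
    then show "1 - \<bar>q s\<bar> \<le> 1 / sqrt (2 * b) * deriv q s"
      using \<open>0 < b\<close> by (simp add: field_simps)
  qed (use \<open>0 < b\<close> in simp)
qed

lemma velocity_integrable: "integrable lborel (deriv q)"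
proof -
  have "set_integrable lborel (einterval (-\<infinity>) \<infinity>) (deriv q)"
  proof (rule interval_integral_FTC_nonneg(1)[where F = q])
    show "((q \<circ> real_of_ereal) \<longlongrightarrow> -1) (at_right (- \<infinity>))" "((q \<circ> real_of_ereal) \<longlongrightarrow> 1) (at_left \<infinity>)"
      using q_bot q_top by (simp_all add: ereal_tendsto_simps)
    show "isCont (deriv q) x" for x using velocity_deriv DERIV_isCont by blast
    show "AE x in lborel. - \<infinity> < ereal x \<longrightarrow> ereal x < \<infinity> \<longrightarrow> 0 \<le> deriv q x"
      using velocity_pos by (intro AE_I2) (simp add: less_imp_le)
  qed (use q_deriv in auto)
  then show ?thesis by (simp add: set_integrable_def)
qed

lemma weight_integrable:
  assumes "continuous_on UNIV f" "bounded (range f)"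
  shows "integrable lborel (\<lambda>s. f s * (deriv q s)\<^sup>2)"
proof -
  obtain B where B: "\<And>s. \<bar>f s\<bar> \<le> B" using assms(2) by (auto simp: bounded_iff)
  obtain C where C: "\<And>s. \<bar>deriv q s\<bar> \<le> C" using velocity_bounded by (auto simp: bounded_iff)
  have "0 \<le> B" using B abs_ge_zero order_trans by blast
  show ?thesis
  proof (rule Bochner_Integration.integrable_bound[OF integrable_mult_right[OF velocity_integrable, of "B * C"]])
    show "(\<lambda>s. f s * (deriv q s)\<^sup>2) \<in> borel_measurable lborel"
      using borel_measurable_continuous_onI[OF continuous_on_mult[OF assms(1) continuous_on_power[OF velocity_continuous]]]
      by simp
    show "AE s in lborel. norm (f s * (deriv q s)\<^sup>2) \<le> norm (B * C * deriv q s)"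
    proof (rule AE_I2)
      fix s
      have "\<bar>f s\<bar> * (deriv q s * \<bar>deriv q s\<bar>) \<le> B * (deriv q s * C)"
        using velocity_pos[of s] by (intro mult_mono B C mult_nonneg_nonneg) (auto simp: \<open>0 \<le> B\<close>)
      then have "\<bar>f s * (deriv q s)\<^sup>2\<bar> \<le> B * C * deriv q s"
        using velocity_pos[of s] by (simp add: abs_mult power2_eq_square mult_ac)
      then show "norm (f s * (deriv q s)\<^sup>2) \<le> norm (B * C * deriv q s)"
        unfolding real_norm_def by linarith
    qed
  qed
qed

text \<open>The vanishing mean makes the primitive from \<open>-\<infinity>\<close> agree with the one from \<open>+\<infinity>\<close>, so on each
  half-line it can be estimated from the nearer end. There \<open>q'\<close> is monotone, hence the integral of
  \<open>q'\<^sup>2\<close> over the tail is at most \<open>q'(s)\<close> times the distance of \<open>q(s)\<close> to the well, which is again of order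
  \<open>q'(s)\<close>.\<close>

lemma weighted_primitive:
  assumes f: "continuous_on UNIV f" "bounded (range f)" and mean: "(LINT s|lborel. f s * (deriv q s)\<^sup>2) = 0"
  obtains \<Phi> C where "\<And>s. (\<Phi> has_real_derivative f s * (deriv q s)\<^sup>2) (at s)"
    "\<And>s. \<bar>\<Phi> s\<bar> \<le> C * (deriv q s)\<^sup>2"
proof -
  obtain B where B: "\<And>s. \<bar>f s\<bar> \<le> B" using f(2) by (auto simp: bounded_iff)
  obtain M where M: "\<And>s. \<bar>deriv q s\<bar> \<le> M" using velocity_bounded by (auto simp: bounded_iff)
  have "0 \<le> B" using B abs_ge_zero order_trans by blast
  have cont: "continuous_on UNIV (\<lambda>s. f s * (deriv q s)\<^sup>2)"
    by (intro continuous_intros f velocity_continuous)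
  have le: "\<bar>f s * (deriv q s)\<^sup>2\<bar> \<le> B * c * deriv q s" if "deriv q s \<le> c" for s c
  proof -
    have "\<bar>f s\<bar> * (deriv q s * deriv q s) \<le> B * (deriv q s * c)"
      using velocity_pos[of s] that by (intro mult_mono B mult_nonneg_nonneg) (auto simp: \<open>0 \<le> B\<close>)
    then show ?thesis using velocity_pos[of s] by (simp add: abs_mult power2_eq_square mult_ac)
  qed
  have le': "\<bar>f s * (deriv q s)\<^sup>2\<bar> \<le> B * M * deriv q s" for s
    using le[of s M] M[of s] by simp
  have qd: "((\<lambda>s. c * q s) has_real_derivative c * deriv q s) (at s)" for c s
    by (auto intro!: derivative_eq_intros q_deriv)
  have "((\<lambda>s. B * M * q s) \<longlongrightarrow> B * M * -1) at_bot"
    by (intro tendsto_intros q_bot)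
  from antiderivative_vanishing_at_bot[OF cont qd le' this]
  obtain \<Phi> where \<Phi>: "\<And>s. (\<Phi> has_real_derivative f s * (deriv q s)\<^sup>2) (at s)"
    "\<And>s. \<bar>\<Phi> s\<bar> \<le> B * M * q s - B * M * -1" by blast
  have cont': "continuous_on UNIV (\<lambda>s. f (- s) * (deriv q (- s))\<^sup>2)"
    by (rule continuous_on_compose2[OF cont]) (auto intro!: continuous_intros)
  have qd': "((\<lambda>s. - (B * M * q (- s))) has_real_derivative B * M * deriv q (- s)) (at s)" for s
    using qd[of "B * M" "- s"] by (auto simp: DERIV_mirror dest: DERIV_minus)
  have "((\<lambda>s. - (B * M * q (- s))) \<longlongrightarrow> - (B * M * 1)) at_bot"
    by (intro tendsto_intros filterlim_compose[OF q_top] filterlim_uminus_at_top_at_bot)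
  from antiderivative_vanishing_at_bot[OF cont' qd' le' this]
  obtain \<Psi> where \<Psi>: "\<And>s. (\<Psi> has_real_derivative f (- s) * (deriv q (- s))\<^sup>2) (at s)"
    "\<And>s. \<bar>\<Psi> s\<bar> \<le> - (B * M * q (- s)) - - (B * M * 1)" by blast
  have "((\<lambda>s. \<Psi> (- s)) has_real_derivative - (f s * (deriv q s)\<^sup>2)) (at s)" for s
    using \<Psi>(1)[of "- s"] by (simp add: DERIV_mirror)
  then have "((\<lambda>s. \<Phi> s + \<Psi> (- s)) has_real_derivative 0) (at s)" for s
    using DERIV_add[OF \<Phi>(1)] by fastforce
  then have const: "\<Phi> s + \<Psi> (- s) = \<Phi> 0 + \<Psi> (- 0)" for s
    using DERIV_isconst_all[of "\<lambda>s. \<Phi> s + \<Psi> (- s)"] by blast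
  \<comment> \<open>The limit of \<open>\<Phi>\<close> at \<open>+\<infinity>\<close>; it is the integral of \<open>f q'\<^sup>2\<close>, hence zero.\<close>
  define K where "K = \<Phi> 0 + \<Psi> (- 0)"
  have \<Phi>_bot: "(\<Phi> \<longlongrightarrow> 0) at_bot"
  proof (rule Lim_null_comparison)
    have "((\<lambda>s. B * M * q s - B * M * -1) \<longlongrightarrow> B * M * -1 - B * M * -1) at_bot"
      by (intro tendsto_intros q_bot)
    then show "((\<lambda>s. B * M * q s - B * M * -1) \<longlongrightarrow> 0) at_bot" by simp
  qed (use \<Phi> in auto)
  have "((\<lambda>s. \<Phi> s - K) \<longlongrightarrow> 0) at_top"
  proof (rule Lim_null_comparison)
    have "((\<lambda>s. - (B * M * q s) - - (B * M * 1)) \<longlongrightarrow> - (B * M * 1) - - (B * M * 1)) at_top"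
      by (intro tendsto_intros q_top)
    then show "((\<lambda>s. - (B * M * q s) - - (B * M * 1)) \<longlongrightarrow> 0) at_top" by simp
    have "\<bar>\<Phi> s - K\<bar> \<le> - (B * M * q s) - - (B * M * 1)" for s
      using \<Psi>(2)[of "- s"] const[of s] by (simp add: K_def)
    then show "\<forall>\<^sub>F s in at_top. norm (\<Phi> s - K) \<le> - (B * M * q s) - - (B * M * 1)" by simp
  qed
  then have \<Phi>_top: "(\<Phi> \<longlongrightarrow> K) at_top" by (simp add: LIM_zero_iff)
  have "(LBINT s=-\<infinity>..\<infinity>. f s * (deriv q s)\<^sup>2) = K - 0"
  proof (rule interval_integral_FTC_integrable[where F = \<Phi>])
    show "((\<Phi> \<circ> real_of_ereal) \<longlongrightarrow> 0) (at_right (- \<infinity>))" "((\<Phi> \<circ> real_of_ereal) \<longlongrightarrow> K) (at_left \<infinity>)"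
      using \<Phi>_bot \<Phi>_top by (simp_all add: ereal_tendsto_simps)
    show "(\<Phi> has_vector_derivative f x * (deriv q x)\<^sup>2) (at x)" for x
      using \<Phi>(1) by (simp add: has_real_derivative_iff_has_vector_derivative)
    show "isCont (\<lambda>s. f s * (deriv q s)\<^sup>2) x" for x
      using cont by (simp add: continuous_on_eq_continuous_at)
    show "set_integrable lborel (einterval (-\<infinity>) \<infinity>) (\<lambda>s. f s * (deriv q s)\<^sup>2)"
      using weight_integrable[OF f] by (simp add: set_integrable_def)
  qed simp
  then have "K = 0"
    using mean by (simp add: interval_lebesgue_integral_def set_lebesgue_integral_def)
  obtain C where C: "0 < C" "\<And>s. 1 - \<bar>q s\<bar> \<le> C * deriv q s"
    using distance_to_wells_le_velocity by blast
  have tail: "\<bar>\<Phi> s\<bar> \<le> B * deriv q s * (1 - \<bar>q s\<bar>)" for s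
  proof (cases "s \<le> 0")
    case True
    have "\<bar>\<Phi> s - 0\<bar> \<le> B * deriv q s * q s - B * deriv q s * -1"
    proof (rule tendsto_le)
      show "((\<lambda>t. \<bar>\<Phi> s - \<Phi> t\<bar>) \<longlongrightarrow> \<bar>\<Phi> s - 0\<bar>) at_bot" by (intro tendsto_intros \<Phi>_bot)
      show "((\<lambda>t. B * deriv q s * q s - B * deriv q s * q t) \<longlongrightarrow> B * deriv q s * q s - B * deriv q s * -1) at_bot"
        by (intro tendsto_intros q_bot)
      have "\<bar>\<Phi> s - \<Phi> t\<bar> \<le> B * deriv q s * q s - B * deriv q s * q t" if "t \<le> s" for t
        by (rule increment_le_of_deriv_le[OF \<Phi>(1) qd[of "B * deriv q s"] le \<open>t \<le> s\<close>])
          (use True velocity_increasing in auto)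
      then show "\<forall>\<^sub>F t in at_bot. \<bar>\<Phi> s - \<Phi> t\<bar> \<le> B * deriv q s * q s - B * deriv q s * q t"
        by (rule eventually_mono[OF eventually_le_at_bot[of s]])
    qed simp
    moreover have "q s \<le> 0" using True q_strict_mono[of s 0] q_zero by (cases "s = 0") auto
    ultimately show ?thesis by (simp add: algebra_simps)
  next
    case False
    have "\<bar>0 - \<Phi> s\<bar> \<le> B * deriv q s * 1 - B * deriv q s * q s"
    proof (rule tendsto_le)
      show "((\<lambda>t. \<bar>\<Phi> t - \<Phi> s\<bar>) \<longlongrightarrow> \<bar>0 - \<Phi> s\<bar>) at_top"
        using \<Phi>_top \<open>K = 0\<close> by (intro tendsto_intros) auto
      show "((\<lambda>t. B * deriv q s * q t - B * deriv q s * q s) \<longlongrightarrow> B * deriv q s * 1 - B * deriv q s * q s) at_top"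
        by (intro tendsto_intros q_top)
      have "\<bar>\<Phi> t - \<Phi> s\<bar> \<le> B * deriv q s * q t - B * deriv q s * q s" if "s \<le> t" for t
        by (rule increment_le_of_deriv_le[OF \<Phi>(1) qd[of "B * deriv q s"] le \<open>s \<le> t\<close>])
          (use False velocity_decreasing in auto)
      then show "\<forall>\<^sub>F t in at_top. \<bar>\<Phi> t - \<Phi> s\<bar> \<le> B * deriv q s * q t - B * deriv q s * q s"
        by (rule eventually_mono[OF eventually_ge_at_top[of s]])
    qed simp
    moreover have "0 \<le> q s" using False q_strict_mono[of 0 s] q_zero by auto
    ultimately show ?thesis by (simp add: algebra_simps)
  qed
  show ?thesis
  proof (rule that[OF \<Phi>(1), of "B * C"])
    fix s
    have "B * deriv q s * (1 - \<bar>q s\<bar>) \<le> B * deriv q s * (C * deriv q s)"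
      using C(2)[of s] \<open>0 \<le> B\<close> velocity_pos[of s] by (intro mult_left_mono) auto
    then show "\<bar>\<Phi> s\<bar> \<le> B * C * (deriv q s)\<^sup>2"
      using tail[of s] by (simp add: power2_eq_square algebra_simps)
  qed
qed

text \<open>Reduction of order with \<open>r = q' w\<close>: the equation becomes \<open>(q'\<^sup>2 w')' = - f q'\<^sup>2\<close>, so
  \<open>w' = - \<Phi> / q'\<^sup>2\<close> is bounded by the preceding estimate. Then \<open>w\<close> grows at most linearly, and \<open>q' w\<close> is
  bounded.\<close>

lemma solvable_at_zero:
  assumes f: "continuous_on UNIV f" "bounded (range f)" and mean: "(LINT s|lborel. f s * (deriv q s)\<^sup>2) = 0"
  obtains r r1 where "\<And>s. (r has_real_derivative r1 s) (at s)"
    "\<And>s. (r1 has_real_derivative W2 (q s) * r s - deriv q s * f s) (at s)" "bounded (range r)"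
proof -
  let ?p = "deriv q"
  obtain \<Phi> C where \<Phi>: "\<And>s. (\<Phi> has_real_derivative f s * (?p s)\<^sup>2) (at s)" "\<And>s. \<bar>\<Phi> s\<bar> \<le> C * (?p s)\<^sup>2"
    using weighted_primitive[OF assms] by blast
  have p0: "?p s \<noteq> 0" for s using velocity_pos[of s] by simp
  have "continuous_on UNIV \<Phi>" using \<Phi>(1) by (meson DERIV_isCont continuous_at_imp_continuous_on)
  then have "continuous_on UNIV (\<lambda>s. - (\<Phi> s / (?p s)\<^sup>2))"
    using p0 by (intro continuous_intros velocity_continuous) auto
  then obtain w0 where w0: "\<And>s. (w0 has_real_derivative - (\<Phi> s / (?p s)\<^sup>2)) (at s)"
    using antiderivative_exists by blast
  define w where "w s = w0 s - w0 0" for s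
  have w: "(w has_real_derivative - (\<Phi> s / (?p s)\<^sup>2)) (at s)" for s
    unfolding w_def using w0 by (auto intro!: derivative_eq_intros)
  have slope: "\<bar>- (\<Phi> s / (?p s)\<^sup>2)\<bar> \<le> C" for s
    using \<Phi>(2)[of s] velocity_pos[of s] by (simp add: abs_div pos_divide_le_eq)
  have wb: "\<bar>w s\<bar> \<le> C * \<bar>s\<bar>" for s
    using field_differentiable_bound[of UNIV w "\<lambda>s. - (\<Phi> s / (?p s)\<^sup>2)" C s 0] w slope
    by (simp add: w_def)
  have "0 \<le> C" using slope abs_ge_zero order_trans by blast
  show ?thesis
  proof (rule that[of "\<lambda>s. ?p s * w s" "\<lambda>s. W1 (q s) * w s - \<Phi> s / ?p s"])
    fix s
    show "((\<lambda>s. ?p s * w s) has_real_derivative W1 (q s) * w s - \<Phi> s / ?p s) (at s)"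
      using p0[of s] by (auto intro!: derivative_eq_intros velocity_deriv w simp: field_simps power2_eq_square)
    show "((\<lambda>s. W1 (q s) * w s - \<Phi> s / ?p s) has_real_derivative
        W2 (q s) * (?p s * w s) - ?p s * f s) (at s)"
      using p0[of s]
      by (auto intro!: derivative_eq_intros along_wave_deriv[OF well_smooth(2)] velocity_deriv w \<Phi>(1)
          simp: field_simps power2_eq_square)
  next
    have "\<bar>?p s * w s\<bar> \<le> C" for s
    proof -
      have "\<bar>?p s * w s\<bar> \<le> ?p s * (C * \<bar>s\<bar>)"
        using wb[of s] velocity_pos[of s] by (simp add: abs_mult)
      also have "\<dots> = C * (\<bar>s\<bar> * ?p s)" by simp
      also have "\<dots> \<le> C * 1" using velocity_times_position_le[of s] \<open>0 \<le> C\<close> by (intro mult_left_mono)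
      finally show ?thesis by simp
    qed
    then show "bounded (range (\<lambda>s. ?p s * w s))" by (auto simp: bounded_iff)
  qed
qed

lemma linearized_equation_solvable:
  assumes h: "bounded_lipschitz h"
    and \<omega>: "0 < \<omega> \<or> \<omega> = 0 \<and> (LINT s|lborel. h s * (deriv q s)\<^sup>2) = 0"
  obtains r r1 where "c2_lipschitz r r1 (\<lambda>s. (\<omega> + W2 (q s)) * r s - deriv q s * h s)"
proof -
  have V: "bounded_lipschitz (\<lambda>s. \<omega> + W2 (q s))"
    by (rule bounded_lipschitz_add[OF bounded_lipschitz_const potential_lipschitz])
  have ph: "bounded_lipschitz (\<lambda>s. deriv q s * h s)"
    by (rule bounded_lipschitz_mult[OF velocity_lipschitz h])
  note h' = bounded_lipschitz_imp_continuous[OF h] bounded_lipschitz_imp_bounded[OF h]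
  obtain r r1 where "\<And>s. (r has_real_derivative r1 s) (at s)"
    "\<And>s. (r1 has_real_derivative (\<omega> + W2 (q s)) * r s - deriv q s * h s) (at s)" "bounded (range r)"
  proof (cases "0 < \<omega>")
    case True
    show thesis
      by (rule schroedinger_resolvent[OF velocity_pos velocity_deriv along_wave_deriv[OF well_smooth(2)]
          velocity_bounded along_wave_bounded[OF well_continuous(2)]
          bounded_lipschitz_imp_continuous[OF potential_lipschitz]
          bounded_lipschitz_imp_bounded[OF potential_lipschitz] h' True]) (rule that)
  next
    case False
    then have "\<omega> = 0" "(LINT s|lborel. h s * (deriv q s)\<^sup>2) = 0" using \<omega> by auto
    then show thesis using solvable_at_zero[OF h'] that by auto
  qed
  then show ?thesis
    using that bounded_solution_imp_c2_lipschitz[OF _ _ _ V ph] by blast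
qed

end

section \<open>Directional derivatives and plane modes\<close>

definition plane_mode :: "(real \<Rightarrow> real) \<Rightarrow> real \<times> (real ^ 'd) \<Rightarrow> real \<Rightarrow> real \<times> (real ^ 'd) \<Rightarrow> real" where
  "plane_mode r a \<phi> z = r (fst z) * cos (a \<bullet> z + \<phi>)"

lemma dir_derivI:
  "((\<lambda>t. f (z + t *\<^sub>R v)) has_real_derivative D) (at 0) \<Longrightarrow> dir_deriv v f z = D"
  unfolding dir_deriv_def by (rule DERIV_imp_deriv)

lemma has_dir_deriv:
  "(\<lambda>t. f (z + t *\<^sub>R v)) differentiable (at 0) \<Longrightarrow>
    ((\<lambda>t. f (z + t *\<^sub>R v)) has_real_derivative dir_deriv v f z) (at 0)"
  unfolding dir_deriv_def by (simp add: DERIV_deriv_iff_real_differentiable)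

lemma C1_has_dir_deriv:
  "C1 f \<Longrightarrow> b \<in> Basis \<Longrightarrow> ((\<lambda>t. f (z + t *\<^sub>R b)) has_real_derivative dir_deriv b f z) (at 0)"
  by (rule has_dir_deriv) (simp add: C1_def)

lemma dir_deriv_add:
  assumes "C1 f" "C1 g" "b \<in> Basis"
  shows "dir_deriv b (\<lambda>z. f z + g z) = (\<lambda>z. dir_deriv b f z + dir_deriv b g z)"
  by (rule ext, rule dir_derivI) (intro DERIV_add C1_has_dir_deriv assms)

lemma dir_deriv_cmult:
  assumes "C1 f" "b \<in> Basis"
  shows "dir_deriv b (\<lambda>z. c * f z) = (\<lambda>z. c * dir_deriv b f z)"
  by (rule ext, rule dir_derivI) (intro DERIV_cmult C1_has_dir_deriv assms)

lemma C1_add: "C1 f \<Longrightarrow> C1 g \<Longrightarrow> C1 (\<lambda>z. f z + g z)"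
  unfolding C1_def[of "\<lambda>z. f z + g z"]
  by (auto simp: dir_deriv_add C1_def intro!: continuous_intros derivative_intros)

lemma C1_cmult: "C1 f \<Longrightarrow> C1 (\<lambda>z. c * f z)"
  unfolding C1_def[of "\<lambda>z. c * f z"]
  by (auto simp: dir_deriv_cmult C1_def intro!: continuous_intros derivative_intros)

lemma C2_imp_C1: "C2 f \<Longrightarrow> C1 f" "C2 f \<Longrightarrow> b \<in> Basis \<Longrightarrow> C1 (dir_deriv b f)"
  by (auto simp: C2_def)

lemma dir_deriv2_add:
  assumes "C2 f" "C2 g" "b \<in> Basis" "b' \<in> Basis"
  shows "dir_deriv b (dir_deriv b' (\<lambda>z. f z + g z)) =
    (\<lambda>z. dir_deriv b (dir_deriv b' f) z + dir_deriv b (dir_deriv b' g) z)"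
  using assms by (simp add: dir_deriv_add C2_imp_C1)

lemma C2_add: "C2 f \<Longrightarrow> C2 g \<Longrightarrow> C2 (\<lambda>z. f z + g z)"
  by (auto simp: C2_def dir_deriv_add intro: C1_add)

lemma plane_mode_has_deriv:
  assumes "\<And>s. (r has_real_derivative r1 s) (at s)"
  shows "((\<lambda>t. plane_mode r a \<phi> (z + t *\<^sub>R v)) has_real_derivative
    fst v * plane_mode r1 a \<phi> z + (a \<bullet> v) * plane_mode r a (\<phi> + pi / 2) z) (at 0)"
proof -
  have r: "((\<lambda>t. r (fst z + t * fst v)) has_real_derivative r1 (fst z) * fst v) (at 0)"
    by (rule DERIV_chain2[where f = r]) (auto intro!: derivative_eq_intros assms)
  have "((\<lambda>t. r (fst z + t * fst v) * cos (a \<bullet> z + t * (a \<bullet> v) + \<phi>)) has_real_derivative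
    r1 (fst z) * fst v * cos (a \<bullet> z + \<phi>) - r (fst z) * (sin (a \<bullet> z + \<phi>) * (a \<bullet> v))) (at 0)"
    by (auto intro!: derivative_eq_intros r)
  moreover have "cos (a \<bullet> z + (\<phi> + pi / 2)) = - sin (a \<bullet> z + \<phi>)"
    by (simp add: minus_sin_cos_eq add.assoc)
  ultimately show ?thesis
    by (simp add: plane_mode_def inner_add_right algebra_simps)
qed

lemmas plane_mode_dir_deriv = dir_derivI[OF plane_mode_has_deriv]

lemma continuous_plane_mode:
  fixes a :: "real \<times> (real ^ 'd)"
  assumes "continuous_on UNIV r"
  shows "continuous_on UNIV (plane_mode r a \<phi>)"
proof -
  have "continuous_on UNIV (\<lambda>z :: real \<times> (real ^ 'd). r (fst z))"
    by (rule continuous_on_compose2[OF assms continuous_on_fst[OF continuous_on_id]]) simp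
  then show ?thesis
    unfolding plane_mode_def by (intro continuous_intros)
qed

lemma C1_plane_mode:
  assumes r: "\<And>s. (r has_real_derivative r1 s) (at s)" and r1: "continuous_on UNIV r1"
  shows "C1 (plane_mode r a \<phi>)"
proof -
  have "continuous_on UNIV r" using r by (meson DERIV_isCont continuous_at_imp_continuous_on)
  moreover have "dir_deriv b (plane_mode r a \<phi>) =
      (\<lambda>z. fst b * plane_mode r1 a \<phi> z + (a \<bullet> b) * plane_mode r a (\<phi> + pi / 2) z)" for b
    using plane_mode_dir_deriv[OF r] by blast
  moreover have "(\<lambda>t. plane_mode r a \<phi> (z + t *\<^sub>R b)) differentiable (at 0)" for z b
    using plane_mode_has_deriv[OF r] real_differentiable_def by blast
  ultimately show ?thesis
    unfolding C1_def by (auto intro!: continuous_intros continuous_plane_mode r1)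
qed

lemma bounded_lipschitz_plane_mode [bounded_lipschitz_intros]:
  assumes "bounded_lipschitz r"
  shows "bounded_lipschitz (plane_mode r a \<phi>)"
proof -
  obtain B L where r: "0 \<le> B" "0 \<le> L" "\<And>x. \<bar>r x\<bar> \<le> B" "\<And>x y. \<bar>r x - r y\<bar> \<le> L * dist x y"
    using bounded_lipschitz_obtain[OF assms] by blast
  have "bounded_lipschitz (\<lambda>z :: real \<times> (real ^ 'd). r (fst z))"
  proof (rule bounded_lipschitzI[OF r(2) r(3)])
    show "\<bar>r (fst z) - r (fst w)\<bar> \<le> L * dist z w" for z w :: "real \<times> (real ^ 'd)"
      using r(4)[of "fst z" "fst w"] mult_left_mono[OF dist_fst_le r(2)] by (rule order_trans)
  qed
  moreover have "bounded_lipschitz (\<lambda>z. cos (a \<bullet> z + \<phi>))"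
  proof (rule bounded_lipschitzI[of "norm a" _ 1])
    show "\<bar>cos (a \<bullet> z + \<phi>) - cos (a \<bullet> w + \<phi>)\<bar> \<le> norm a * dist z w" for z w
    proof -
      have "\<bar>cos (a \<bullet> z + \<phi>) - cos (a \<bullet> w + \<phi>)\<bar> \<le> 1 * \<bar>(a \<bullet> z + \<phi>) - (a \<bullet> w + \<phi>)\<bar>"
        using field_differentiable_bound[of UNIV cos "\<lambda>x. - sin x" 1 "a \<bullet> z + \<phi>" "a \<bullet> w + \<phi>"]
        by (auto intro!: derivative_eq_intros)
      also have "\<dots> = \<bar>a \<bullet> (z - w)\<bar>" by (simp add: inner_diff_right)
      also have "\<dots> \<le> norm a * norm (z - w)" by (rule Cauchy_Schwarz_ineq2)
      finally show ?thesis by (simp add: dist_norm)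
    qed
  qed auto
  ultimately show ?thesis
    unfolding plane_mode_def by (rule bounded_lipschitz_mult)
qed

lemma inner_int_lattice:
  assumes "k \<in> int_lattice" "k' \<in> int_lattice"
  shows "k \<bullet> k' \<in> \<int>"
  using assms unfolding inner_vec_def int_lattice_def by (auto intro!: Ints_sum Ints_mult)

lemma plane_mode_periodic:
  assumes "k \<in> int_lattice" "k' \<in> int_lattice"
  shows "plane_mode r (\<alpha>, (2 * pi) *\<^sub>R k) \<phi> (s, y + k') = plane_mode r (\<alpha>, (2 * pi) *\<^sub>R k) \<phi> (s, y)"
proof -
  obtain n where n: "k \<bullet> k' = of_int n"
    using inner_int_lattice[OF assms] Ints_cases by blast
  have "cos (\<alpha> * s + 2 * pi * (k \<bullet> y) + \<phi> + 2 * pi * of_int n) = cos (\<alpha> * s + 2 * pi * (k \<bullet> y) + \<phi>)"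
    by (metis cos_int_2pin cos_add sin_int_2pin mult.commute mult_1_right mult_zero_right diff_zero)
  then show ?thesis by (simp add: plane_mode_def inner_add_right n algebra_simps)
qed

text \<open>Periodicity allows replacing \<open>y - y'\<close> by an almost shortest representative, which turns the Euclidean
  Lipschitz bound into one for the torus distance; for distances above \<open>1\<close> the bound on \<open>D\<close> takes over.\<close>

lemma periodic_lipschitz_imp_holder:
  fixes D :: "real \<times> (real ^ 'd) \<Rightarrow> real"
  assumes D: "bounded_lipschitz D" and per: "\<And>s y k. k \<in> int_lattice \<Longrightarrow> D (s, y + k) = D (s, y)"
    and "0 < \<mu>" "\<mu> < 1"
  shows "\<exists>C. \<forall>s y s' y'. \<bar>D (s, y) - D (s', y')\<bar> \<le> C * norm (s - s', torus_norm (y - y')) powr \<mu>"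
proof -
  obtain B L where BL: "0 \<le> B" "0 \<le> L" "\<And>x. \<bar>D x\<bar> \<le> B" "\<And>x y. \<bar>D x - D y\<bar> \<le> L * dist x y"
    using bounded_lipschitz_obtain[OF D] by blast
  have lip: "\<bar>D (s, y) - D (s', y')\<bar> \<le> L * norm (s - s', torus_norm (y - y'))" for s y s' y'
  proof (rule field_le_epsilon)
    fix \<epsilon> :: real assume "0 < \<epsilon>"
    \<comment> \<open>The tolerance within which a lattice translate realizes the torus distance; the denominator makes \<open>L \<delta> \<le> \<epsilon>\<close>, also when \<open>L = 0\<close>.\<close>
    define \<delta> where "\<delta> = \<epsilon> / (L + 1)"
    have "0 < \<delta>" using \<open>0 < \<epsilon>\<close> BL(2) by (simp add: \<delta>_def)
    have "0 \<in> int_lattice" by (simp add: int_lattice_def)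
    then have "(\<lambda>k. norm (y - y' + k)) ` int_lattice \<noteq> {}" by blast
    moreover have "Inf ((\<lambda>k. norm (y - y' + k)) ` int_lattice) < torus_norm (y - y') + \<delta>"
      using \<open>0 < \<delta>\<close> by (simp add: torus_norm_def)
    ultimately have "\<exists>x \<in> (\<lambda>k. norm (y - y' + k)) ` int_lattice. x < torus_norm (y - y') + \<delta>"
      by (rule cInf_lessD)
    then obtain k where k: "k \<in> int_lattice" "norm (y - y' + k) < torus_norm (y - y') + \<delta>"
      by blast
    have "dist (s, y + k) (s', y') = norm (s - s', norm (y - y' + k))"
      by (simp add: dist_norm norm_Pair algebra_simps)
    also have "\<dots> \<le> norm (s - s', torus_norm (y - y') + \<delta>)"
      using k(2) by (simp add: norm_Pair power_mono)
    also have "\<dots> = norm ((s - s', torus_norm (y - y')) + (0, \<delta>))" by simp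
    also have "\<dots> \<le> norm (s - s', torus_norm (y - y')) + \<delta>"
      using norm_triangle_ineq[of "(s - s', torus_norm (y - y'))" "(0, \<delta>)"] \<open>0 < \<delta>\<close> by (simp add: norm_Pair)
    finally have "L * dist (s, y + k) (s', y') \<le> L * (norm (s - s', torus_norm (y - y')) + \<delta>)"
      using BL(2) by (rule mult_left_mono)
    moreover have "L * \<delta> \<le> \<epsilon>" using BL(2) \<open>0 < \<epsilon>\<close> by (simp add: \<delta>_def field_simps)
    moreover have "\<bar>D (s, y) - D (s', y')\<bar> \<le> L * dist (s, y + k) (s', y')"
      using BL(4)[of "(s, y + k)" "(s', y')"] per[OF k(1)] by simp
    ultimately show "\<bar>D (s, y) - D (s', y')\<bar> \<le> L * norm (s - s', torus_norm (y - y')) + \<epsilon>"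
      by (simp add: algebra_simps)
  qed
  have "\<bar>D (s, y) - D (s', y')\<bar> \<le> (L + 2 * B) * norm (s - s', torus_norm (y - y')) powr \<mu>" for s y s' y'
  proof -
    define n where "n = norm (s - s', torus_norm (y - y'))"
    have "0 \<le> n" by (simp add: n_def)
    show ?thesis unfolding n_def[symmetric]
    proof (cases "n \<le> 1")
      case True
      have "n \<le> n powr \<mu>"
        using powr_mono'[of \<mu> 1 n] True \<open>0 \<le> n\<close> assms by simp
      then have "L * n \<le> (L + 2 * B) * n powr \<mu>"
        using BL \<open>0 \<le> n\<close> by (intro mult_mono) auto
      then show "\<bar>D (s, y) - D (s', y')\<bar> \<le> (L + 2 * B) * n powr \<mu>"
        using lip[of s y s' y'] by (simp add: n_def)
    next
      case False
      then have "1 \<le> n powr \<mu>" using assms by (simp add: ge_one_powr_ge_zero)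
      then have "2 * B * 1 \<le> (L + 2 * B) * n powr \<mu>" using BL by (intro mult_mono) auto
      then show "\<bar>D (s, y) - D (s', y')\<bar> \<le> (L + 2 * B) * n powr \<mu>"
        using BL(3)[of "(s, y)"] BL(3)[of "(s', y')"] by linarith
    qed
  qed
  then show ?thesis by blast
qed

lemma plane_mode_dir_deriv2:
  assumes "c2_lipschitz r r1 r2"
  shows "dir_deriv b (dir_deriv b' (plane_mode r a \<phi>)) =
    (\<lambda>z. fst b' * (fst b * plane_mode r2 a \<phi> z + (a \<bullet> b) * plane_mode r1 a (\<phi> + pi / 2) z)
       + (a \<bullet> b') * (fst b * plane_mode r1 a (\<phi> + pi / 2) z + (a \<bullet> b) * plane_mode r a (\<phi> + pi / 2 + pi / 2) z))"
proof -
  have r: "\<And>s. (r has_real_derivative r1 s) (at s)" "\<And>s. (r1 has_real_derivative r2 s) (at s)"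
    using assms by (auto simp: c2_lipschitz_def)
  have "dir_deriv b' (plane_mode r a \<phi>) =
      (\<lambda>z. fst b' * plane_mode r1 a \<phi> z + (a \<bullet> b') * plane_mode r a (\<phi> + pi / 2) z)"
    using plane_mode_dir_deriv[OF r(1)] by blast
  then show ?thesis
    by (simp only:) (intro ext dir_derivI DERIV_add DERIV_cmult plane_mode_has_deriv r)
qed

lemma plane_mode_C2_holder:
  assumes r: "c2_lipschitz r r1 r2" and k: "k \<in> int_lattice" and \<mu>: "0 < \<mu>" "\<mu> < 1"
  shows "plane_mode r (\<alpha>, (2 * pi) *\<^sub>R k) \<phi> \<in> C2_holder \<mu>"
proof -
  let ?a = "(\<alpha>, (2 * pi) *\<^sub>R k)"
  have r': "\<And>s. (r has_real_derivative r1 s) (at s)" "\<And>s. (r1 has_real_derivative r2 s) (at s)"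
    "bounded_lipschitz r" "bounded_lipschitz r1" "bounded_lipschitz r2"
    using r by (auto simp: c2_lipschitz_def)
  have d1: "dir_deriv b (plane_mode r ?a \<phi>) =
      (\<lambda>z. fst b * plane_mode r1 ?a \<phi> z + (?a \<bullet> b) * plane_mode r ?a (\<phi> + pi / 2) z)" for b
    using plane_mode_dir_deriv[OF r'(1)] by blast
  note cont = bounded_lipschitz_imp_continuous
  have C1: "C1 (plane_mode r ?a \<psi>)" "C1 (plane_mode r1 ?a \<psi>)" for \<psi>
    using C1_plane_mode[OF r'(1)] C1_plane_mode[OF r'(2)] cont r' by blast+
  have C2: "C2 (plane_mode r ?a \<phi>)"
    unfolding C2_def d1 by (intro conjI ballI C1_add C1_cmult C1)
  have bl: "bounded_lipschitz (dir_deriv b (dir_deriv b' (plane_mode r ?a \<phi>)))" for b b'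
    unfolding plane_mode_dir_deriv2[OF r] by (intro bounded_lipschitz_intros r')
  have per: "dir_deriv b (dir_deriv b' (plane_mode r ?a \<phi>)) (s, y + k') =
      dir_deriv b (dir_deriv b' (plane_mode r ?a \<phi>)) (s, y)" if "k' \<in> int_lattice" for b b' s y k'
    unfolding plane_mode_dir_deriv2[OF r] plane_mode_periodic[OF k that] ..
  have "bounded (range (plane_mode r ?a \<phi>))" "bounded (range (dir_deriv b (plane_mode r ?a \<phi>)))" for b
    unfolding d1 by (intro bounded_lipschitz_imp_bounded bounded_lipschitz_intros r')+
  then show ?thesis
    unfolding C2_holder_def
    using C2 plane_mode_periodic[OF k] bounded_lipschitz_imp_bounded[OF bl]
      periodic_lipschitz_imp_holder[OF bl per \<mu>] by auto
qed

lemma C2_holderD: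
  assumes "P \<in> C2_holder \<mu>"
  shows "k \<in> int_lattice \<Longrightarrow> P (s, y + k) = P (s, y)" "C2 P" "bounded (range P)"
    "b \<in> Basis \<Longrightarrow> bounded (range (dir_deriv b P))"
    "b \<in> Basis \<Longrightarrow> b' \<in> Basis \<Longrightarrow> bounded (range (dir_deriv b (dir_deriv b' P)))"
    "b \<in> Basis \<Longrightarrow> b' \<in> Basis \<Longrightarrow> \<exists>C. \<forall>s y s' y'.
        \<bar>dir_deriv b (dir_deriv b' P) (s, y) - dir_deriv b (dir_deriv b' P) (s', y')\<bar>
          \<le> C * norm (s - s', torus_norm (y - y')) powr \<mu>"
  using assms unfolding C2_holder_def by blast+

lemma C2_holder_add:
  assumes P: "P \<in> C2_holder \<mu>" and Q: "Q \<in> C2_holder \<mu>"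
  shows "(\<lambda>z. P z + Q z) \<in> C2_holder \<mu>"
proof -
  note C2 = C2_holderD(2)[OF P] C2_holderD(2)[OF Q]
  have "\<exists>C. \<forall>s y s' y'. \<bar>(f (s, y) + g (s, y)) - (f (s', y') + g (s', y'))\<bar>
      \<le> C * norm (s - s', torus_norm (y - y')) powr \<mu>"
    if f: "\<exists>C. \<forall>s y s' y'. \<bar>f (s, y) - f (s', y')\<bar> \<le> C * norm (s - s', torus_norm (y - y')) powr \<mu>"
      and g: "\<exists>C. \<forall>s y s' y'. \<bar>g (s, y) - g (s', y')\<bar> \<le> C * norm (s - s', torus_norm (y - y')) powr \<mu>"
    for f g :: "real \<times> (real ^ 'a) \<Rightarrow> real"
  proof -
    obtain C where C: "\<And>s y s' y'. \<bar>f (s, y) - f (s', y')\<bar> \<le> C * norm (s - s', torus_norm (y - y')) powr \<mu>"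
      using f by blast
    obtain D where D: "\<And>s y s' y'. \<bar>g (s, y) - g (s', y')\<bar> \<le> D * norm (s - s', torus_norm (y - y')) powr \<mu>"
      using g by blast
    have "\<bar>(f (s, y) + g (s, y)) - (f (s', y') + g (s', y'))\<bar>
        \<le> (C + D) * norm (s - s', torus_norm (y - y')) powr \<mu>" for s y s' y'
      using C[of s y s' y'] D[of s y s' y'] unfolding distrib_right by linarith
    then show ?thesis by blast
  qed
  note holder = this
  show ?thesis
    unfolding C2_holder_def mem_Collect_eq
  proof (intro conjI allI ballI)
    fix b b' :: "real \<times> (real ^ 'a)" assume b: "b \<in> Basis" and b': "b' \<in> Basis"
    show "bounded (range (dir_deriv b (\<lambda>z. P z + Q z)))"
      unfolding dir_deriv_add[OF C2[THEN C2_imp_C1(1)] b]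
      using P Q b by (intro bounded_plus_comp C2_holderD(4))
    show "bounded (range (dir_deriv b (dir_deriv b' (\<lambda>z. P z + Q z))))"
      unfolding dir_deriv2_add[OF C2 b b']
      using P Q b b' by (intro bounded_plus_comp C2_holderD(5))
    show "\<exists>C. \<forall>s y s' y'. \<bar>dir_deriv b (dir_deriv b' (\<lambda>z. P z + Q z)) (s, y)
        - dir_deriv b (dir_deriv b' (\<lambda>z. P z + Q z)) (s', y')\<bar>
      \<le> C * norm (s - s', torus_norm (y - y')) powr \<mu>"
      unfolding dir_deriv2_add[OF C2 b b']
      by (intro holder C2_holderD(6)[OF P b b'] C2_holderD(6)[OF Q b b'])
  next
    show "bounded (range (\<lambda>z. P z + Q z))"
      by (intro bounded_plus_comp C2_holderD(3)[OF P] C2_holderD(3)[OF Q])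
    show "C2 (\<lambda>z. P z + Q z)" by (rule C2_add[OF C2])
    show "P (s, y + k) + Q (s, y + k) = P (s, y) + Q (s, y)" if "k \<in> int_lattice" for s y k
      using C2_holderD(1)[OF P that] C2_holderD(1)[OF Q that] by simp
  qed
qed

section \<open>The operator on plane modes\<close>

lemma Basis_time_space:
  "(1, 0) \<in> (Basis :: (real \<times> (real ^ 'd)) set)" "(0, axis i 1) \<in> (Basis :: (real \<times> (real ^ 'd)) set)"
  by (auto simp: Basis_prod_def axis_in_Basis_iff)

lemma D_adj_D_op_expand:
  fixes P :: "real \<times> (real ^ 'd) \<Rightarrow> real"
  assumes "C2 P"
  shows "D_adj e (D_op e P) z =
    - (\<Sum>i\<in>UNIV. e $ i * (e $ i * d_s (d_s P) z + d_s (d_y i P) z) + (e $ i * d_y i (d_s P) z + d_y i (d_y i P) z))"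
proof -
  have comp: "(\<lambda>w. D_op e P w $ i) = (\<lambda>w. e $ i * d_s P w + d_y i P w)" for i
    by (auto simp: D_op_def mult.commute)
  have "dir_deriv b (\<lambda>w. e $ i * d_s P w + d_y i P w) z = e $ i * dir_deriv b (d_s P) z + dir_deriv b (d_y i P) z"
    if "b \<in> Basis" for b i
    using that assms
    by (simp add: Basis_time_space d_s_def d_y_def dir_deriv_add dir_deriv_cmult C1_cmult C2_imp_C1)
  then show ?thesis
    by (simp add: Basis_time_space D_adj_def comp d_s_def d_y_def)
qed

lemma D_adj_D_op_add:
  assumes "C2 P" "C2 Q"
  shows "D_adj e (D_op e (\<lambda>z. P z + Q z)) z = D_adj e (D_op e P) z + D_adj e (D_op e Q) z"
proof -
  have "dir_deriv b (dir_deriv b' (\<lambda>z. P z + Q z)) z =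
      dir_deriv b (dir_deriv b' P) z + dir_deriv b (dir_deriv b' Q) z" if "b \<in> Basis" "b' \<in> Basis" for b b'
    using dir_deriv2_add[OF assms that] by simp
  then show ?thesis
    using assms
    by (simp add: Basis_time_space D_adj_D_op_expand C2_add d_s_def d_y_def sum.distrib algebra_simps)
qed

text \<open>The time frequency \<open>\<alpha>\<close> is the one of a function of \<open>y - s e\<close>. Since \<open>|e| = 1\<close>, the terms with the
  first derivative of \<open>r\<close> cancel.\<close>

lemma D_adj_D_op_plane_mode:
  fixes e k :: "real ^ 'd"
  assumes r: "c2_lipschitz r r1 r2" and k: "k \<in> int_lattice" and e: "norm e = 1"
  defines "\<alpha> \<equiv> - (2 * pi * (k \<bullet> e))"
  shows "D_adj e (D_op e (plane_mode r (\<alpha>, (2 * pi) *\<^sub>R k) \<phi>)) z =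
    4 * pi\<^sup>2 * (k \<bullet> k - (k \<bullet> e)\<^sup>2) * plane_mode r (\<alpha>, (2 * pi) *\<^sub>R k) \<phi> z - plane_mode r2 (\<alpha>, (2 * pi) *\<^sub>R k) \<phi> z"
proof -
  let ?a = "(\<alpha>, (2 * pi) *\<^sub>R k)"
  let ?P = "plane_mode r ?a \<phi>"
  define X where "X = plane_mode r2 ?a \<phi> z"
  define Y where "Y = plane_mode r1 ?a (\<phi> + pi / 2) z"
  define Z where "Z = ?P z"
  have C2: "C2 ?P"
    by (rule C2_holderD(2)[OF plane_mode_C2_holder[OF r k, of "1/2"]]) simp_all
  have Z: "plane_mode r ?a (\<phi> + pi / 2 + pi / 2) z = - Z"
  proof -
    have "?a \<bullet> z + (\<phi> + pi / 2 + pi / 2) = ?a \<bullet> z + \<phi> + pi" by simp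
    then show ?thesis by (simp only: Z_def plane_mode_def cos_periodic_pi mult_minus_right)
  qed
  have a: "?a \<bullet> (1, 0) = \<alpha>" "?a \<bullet> (0, axis i 1) = 2 * pi * k $ i" for i
    by (simp_all add: inner_axis)
  have dd: "d_s (d_s ?P) z = X + 2 * \<alpha> * Y - \<alpha>\<^sup>2 * Z"
    "d_s (d_y i ?P) z = 2 * pi * k $ i * (Y - \<alpha> * Z)"
    "d_y i (d_s ?P) z = 2 * pi * k $ i * (Y - \<alpha> * Z)"
    "d_y i (d_y i ?P) z = - (2 * pi * k $ i)\<^sup>2 * Z" for i
    unfolding d_s_def d_y_def plane_mode_dir_deriv2[OF r] Z a fst_conv X_def[symmetric] Y_def[symmetric]
    by (simp_all add: algebra_simps power2_eq_square)
  have "D_adj e (D_op e ?P) z = - (\<Sum>i\<in>UNIV. (e $ i * e $ i) * (X + 2 * \<alpha> * Y - \<alpha>\<^sup>2 * Z)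
      + (k $ i * e $ i) * (4 * pi * (Y - \<alpha> * Z)) - (k $ i * k $ i) * (4 * pi\<^sup>2 * Z))"
    unfolding D_adj_D_op_expand[OF C2] dd
    by (intro arg_cong[where f = uminus] sum.cong refl) (simp add: algebra_simps power2_eq_square)
  also have "\<dots> = - ((e \<bullet> e) * (X + 2 * \<alpha> * Y - \<alpha>\<^sup>2 * Z)
      + (k \<bullet> e) * (4 * pi * (Y - \<alpha> * Z)) - (k \<bullet> k) * (4 * pi\<^sup>2 * Z))"
    by (simp only: inner_vec_def inner_real_def sum.distrib sum_subtractf sum_distrib_right)
  also have "e \<bullet> e = 1" using e by (simp add: dot_square_norm)
  finally show ?thesis
    unfolding X_def[symmetric] Z_def[symmetric]
    by (simp add: \<alpha>_def algebra_simps power2_eq_square)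
qed

text \<open>The strict Cauchy-Schwarz inequality: the right-hand side is the squared length of the component of
  \<open>k\<close> orthogonal to \<open>e\<close>, and \<open>k\<close> parallel to \<open>e\<close> would make \<open>e\<close> a rational direction.\<close>

lemma irrational_direction_gap:
  fixes e k :: "real ^ 'd"
  assumes e: "norm e = 1" "e \<notin> rational_directions" and k: "k \<in> int_lattice" "k \<noteq> 0"
  shows "0 < k \<bullet> k - (k \<bullet> e)\<^sup>2"
proof -
  have ee: "e \<bullet> e = 1" using e(1) by (simp add: dot_square_norm)
  have "k - (k \<bullet> e) *\<^sub>R e \<noteq> 0"
  proof
    assume "k - (k \<bullet> e) *\<^sub>R e = 0"
    then have eq: "k = (k \<bullet> e) *\<^sub>R e" by simp
    with k have "k \<bullet> e \<noteq> 0" by auto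
    then have "e = inverse (k \<bullet> e) *\<^sub>R k" by (subst eq) simp
    then show False using e(2) k(1) by (auto simp: rational_directions_def)
  qed
  then have "0 < (k - (k \<bullet> e) *\<^sub>R e) \<bullet> (k - (k \<bullet> e) *\<^sub>R e)" by simp
  also have "\<dots> = k \<bullet> k - (k \<bullet> e)\<^sup>2"
    by (simp add: inner_diff_left inner_diff_right ee power2_eq_square inner_commute)
  finally show ?thesis .
qed

context allen_cahn_wave begin

lemma plane_mode_solvable:
  fixes e k :: "real ^ 'd"
  assumes k: "k \<in> int_lattice" and e: "norm e = 1" "e \<notin> rational_directions" and \<mu>: "0 < \<mu>" "\<mu> < 1"
    and h: "bounded_lipschitz h" and zero: "k = 0 \<Longrightarrow> (LINT s|lborel. h s * (deriv q s)\<^sup>2) = 0"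
  obtains P where "P \<in> C2_holder \<mu>"
    "\<And>s y. D_adj e (D_op e P) (s, y) + W2 (q s) * P (s, y) =
      deriv q s * h s * cos (2 * pi * (k \<bullet> (y - s *\<^sub>R e)) + \<phi>)"
proof -
  define \<omega> where "\<omega> = 4 * pi\<^sup>2 * (k \<bullet> k - (k \<bullet> e)\<^sup>2)"
  have "0 < \<omega> \<or> \<omega> = 0 \<and> (LINT s|lborel. h s * (deriv q s)\<^sup>2) = 0"
    using irrational_direction_gap[OF e k] zero by (cases "k = 0") (auto simp: \<omega>_def)
  then obtain r r1 where r: "c2_lipschitz r r1 (\<lambda>s. (\<omega> + W2 (q s)) * r s - deriv q s * h s)"
    using linearized_equation_solvable[OF h] by blast
  let ?P = "plane_mode r (- (2 * pi * (k \<bullet> e)), (2 * pi) *\<^sub>R k) \<phi>"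
  show ?thesis
  proof (rule that[of ?P])
    show "?P \<in> C2_holder \<mu>" by (rule plane_mode_C2_holder[OF r k \<mu>])
    show "D_adj e (D_op e ?P) (s, y) + W2 (q s) * ?P (s, y) =
        deriv q s * h s * cos (2 * pi * (k \<bullet> (y - s *\<^sub>R e)) + \<phi>)" for s y
      unfolding D_adj_D_op_plane_mode[OF r k e(1)] \<omega>_def[symmetric]
      by (simp add: plane_mode_def inner_diff_right algebra_simps)
  qed
qed

text \<open>A forcing in the variable \<open>y\<close> is rewritten in the moving variable \<open>y - s e\<close> by the addition theorem,
  at the price of the factors \<open>cos (\<beta> s)\<close> and \<open>sin (\<beta> s)\<close>, which are still bounded and Lipschitz. For
  \<open>k = 0\<close> the frequency \<open>\<beta>\<close> vanishes, so the solvability condition is preserved.\<close>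

lemma mode_solvable:
  fixes e k :: "real ^ 'd"
  assumes k: "k \<in> int_lattice" and e: "norm e = 1" "e \<notin> rational_directions" and \<mu>: "0 < \<mu>" "\<mu> < 1"
    and h: "bounded_lipschitz h" and zero: "k = 0 \<Longrightarrow> (LINT s|lborel. h s * (deriv q s)\<^sup>2) = 0"
  obtains P where "P \<in> C2_holder \<mu>"
    "\<And>s y. D_adj e (D_op e P) (s, y) + W2 (q s) * P (s, y) =
      deriv q s * h s * cos (2 * pi * (k \<bullet> y) + \<phi>)"
proof -
  define \<beta> where "\<beta> = 2 * pi * (k \<bullet> e)"
  have "bounded_lipschitz (\<lambda>s. cos (\<beta> * s + \<psi>))" for \<psi>
  proof (rule bounded_lipschitz_of_deriv)
    show "((\<lambda>s. cos (\<beta> * s + \<psi>)) has_real_derivative - (sin (\<beta> * s + \<psi>) * \<beta>)) (at s)" for s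
      by (auto intro!: derivative_eq_intros)
    show "bounded (range (\<lambda>s. cos (\<beta> * s + \<psi>)))"
      by (rule boundedI[of _ 1]) auto
    show "bounded (range (\<lambda>s. - (sin (\<beta> * s + \<psi>) * \<beta>)))"
      by (rule boundedI[of _ "\<bar>\<beta>\<bar>"]) (auto simp: abs_mult intro!: mult_left_le_one_le)
  qed
  from this[of 0] this[of "- pi / 2"]
  have trig: "bounded_lipschitz (\<lambda>s. cos (\<beta> * s))" "bounded_lipschitz (\<lambda>s. sin (\<beta> * s))"
    by (simp_all add: cos_add cos_diff)
  obtain P where P: "P \<in> C2_holder \<mu>"
    "\<And>s y. D_adj e (D_op e P) (s, y) + W2 (q s) * P (s, y) =
      deriv q s * (h s * cos (\<beta> * s)) * cos (2 * pi * (k \<bullet> (y - s *\<^sub>R e)) + \<phi>)"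
  proof (rule plane_mode_solvable[OF k e \<mu>, where h = "\<lambda>s. h s * cos (\<beta> * s)" and \<phi> = \<phi>])
    show "bounded_lipschitz (\<lambda>s. h s * cos (\<beta> * s))" by (rule bounded_lipschitz_mult[OF h trig(1)])
    show "(LINT s|lborel. h s * cos (\<beta> * s) * (deriv q s)\<^sup>2) = 0" if "k = 0"
      using zero[OF that] that by (simp add: \<beta>_def)
  qed blast
  obtain Q where Q: "Q \<in> C2_holder \<mu>"
    "\<And>s y. D_adj e (D_op e Q) (s, y) + W2 (q s) * Q (s, y) =
      deriv q s * (h s * sin (\<beta> * s)) * cos (2 * pi * (k \<bullet> (y - s *\<^sub>R e)) + (\<phi> + pi / 2))"
  proof (rule plane_mode_solvable[OF k e \<mu>, where h = "\<lambda>s. h s * sin (\<beta> * s)" and \<phi> = "\<phi> + pi / 2"])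
    show "bounded_lipschitz (\<lambda>s. h s * sin (\<beta> * s))" by (rule bounded_lipschitz_mult[OF h trig(2)])
    show "(LINT s|lborel. h s * sin (\<beta> * s) * (deriv q s)\<^sup>2) = 0" if "k = 0"
      using that by (simp add: \<beta>_def)
  qed blast
  note C2 = C2_holderD(2)[OF P(1)] C2_holderD(2)[OF Q(1)]
  show ?thesis
  proof (rule that[OF C2_holder_add[OF P(1) Q(1)]])
    fix s y
    define \<psi> where "\<psi> = 2 * pi * (k \<bullet> (y - s *\<^sub>R e)) + \<phi>"
    have "2 * pi * (k \<bullet> y) + \<phi> = \<psi> + \<beta> * s"
      by (simp add: \<psi>_def \<beta>_def inner_diff_right algebra_simps)
    moreover have "cos (\<psi> + \<beta> * s) = cos (\<beta> * s) * cos \<psi> + sin (\<beta> * s) * cos (\<psi> + pi / 2)"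
      by (simp add: cos_add)
    ultimately have "deriv q s * h s * cos (2 * pi * (k \<bullet> y) + \<phi>) =
      deriv q s * (h s * cos (\<beta> * s)) * cos \<psi> + deriv q s * (h s * sin (\<beta> * s)) * cos (\<psi> + pi / 2)"
      by (simp add: algebra_simps)
    then show "D_adj e (D_op e (\<lambda>z. P z + Q z)) (s, y) + W2 (q s) * (P (s, y) + Q (s, y)) =
      deriv q s * h s * cos (2 * pi * (k \<bullet> y) + \<phi>)"
      using P(2)[of s y] Q(2)[of s y]
      by (simp add: D_adj_D_op_add[OF C2] \<psi>_def add.assoc distrib_left)
  qed
qed

end

section \<open>Density of trigonometric polynomials\<close>

text \<open>The phase \<open>\<phi>\<close> lets one family cover sines and cosines, so that products of modes need a single
  addition theorem. The first variable stands for the speed.\<close>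

inductive_set trig_poly :: "(real \<times> (real ^ 'd) \<Rightarrow> real) set" where
  mode: "k \<in> int_lattice \<Longrightarrow> (\<lambda>z. c * fst z ^ n * cos (2 * pi * (k \<bullet> snd z) + \<phi>)) \<in> trig_poly"
| add: "f \<in> trig_poly \<Longrightarrow> g \<in> trig_poly \<Longrightarrow> (\<lambda>z. f z + g z) \<in> trig_poly"

lemma int_lattice_simps: "0 \<in> int_lattice" "axis i 1 \<in> int_lattice"
  "k \<in> int_lattice \<Longrightarrow> k' \<in> int_lattice \<Longrightarrow> k + k' \<in> int_lattice"
  "k \<in> int_lattice \<Longrightarrow> k' \<in> int_lattice \<Longrightarrow> k - k' \<in> int_lattice"
  by (auto simp: int_lattice_def axis_def)

lemma trig_poly_const: "(\<lambda>z. c) \<in> trig_poly"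
  using trig_poly.mode[OF int_lattice_simps(1), of c 0 0] by simp

lemma trig_poly_mode_mult:
  assumes k: "k \<in> int_lattice" and g: "g \<in> trig_poly"
  shows "(\<lambda>z. (c * fst z ^ n * cos (2 * pi * (k \<bullet> snd z) + \<phi>)) * g z) \<in> trig_poly"
  using g
proof induction
  case (mode k' c' n' \<phi>')
  have "(c * fst z ^ n * cos (2 * pi * (k \<bullet> snd z) + \<phi>)) * (c' * fst z ^ n' * cos (2 * pi * (k' \<bullet> snd z) + \<phi>'))
      = c * c' / 2 * fst z ^ (n + n') * cos (2 * pi * ((k - k') \<bullet> snd z) + (\<phi> - \<phi>'))
        + c * c' / 2 * fst z ^ (n + n') * cos (2 * pi * ((k + k') \<bullet> snd z) + (\<phi> + \<phi>'))" for z
  proof -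
    have "2 * pi * ((k - k') \<bullet> snd z) + (\<phi> - \<phi>') = (2 * pi * (k \<bullet> snd z) + \<phi>) - (2 * pi * (k' \<bullet> snd z) + \<phi>')"
      "2 * pi * ((k + k') \<bullet> snd z) + (\<phi> + \<phi>') = (2 * pi * (k \<bullet> snd z) + \<phi>) + (2 * pi * (k' \<bullet> snd z) + \<phi>')"
      by (simp_all add: inner_diff_left inner_add_left algebra_simps)
    moreover have "(c * a * x) * (c' * b * y) = c * c' / 2 * (a * b) * u + c * c' / 2 * (a * b) * v"
      if "x * y = (u + v) / 2" for a b x y u v :: real
      using that by (simp add: field_simps)
    ultimately show ?thesis
      using cos_times_cos[of "2 * pi * (k \<bullet> snd z) + \<phi>" "2 * pi * (k' \<bullet> snd z) + \<phi>'"]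
      by (simp only: power_add)
  qed
  then show ?case
    by (simp only:) (intro trig_poly.intros int_lattice_simps k mode)
next
  case (add f g)
  then show ?case by (simp only: distrib_left) (intro trig_poly.add)
qed

lemma trig_poly_mult:
  assumes f: "f \<in> trig_poly" and g: "g \<in> trig_poly"
  shows "(\<lambda>z. f z * g z) \<in> trig_poly"
  using f
proof induction
  case (mode k c n \<phi>)
  then show ?case using g by (rule trig_poly_mode_mult)
next
  case (add f g)
  then show ?case by (simp only: distrib_right) (intro trig_poly.add)
qed

lemma trig_poly_sum:
  assumes "finite I" "\<And>i. i \<in> I \<Longrightarrow> f i \<in> trig_poly"
  shows "(\<lambda>z. \<Sum>i\<in>I. f i z) \<in> trig_poly"
  using assms
proof (induction I)
  case empty
  show ?case by (simp add: trig_poly_const)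
next
  case (insert i I)
  then show ?case by (simp add: trig_poly.add)
qed

definition torus_embedding :: "real \<times> (real ^ 'd) \<Rightarrow> real \<times> (real ^ 'd) \<times> (real ^ 'd)" where
  "torus_embedding z = (fst z, (\<chi> i. cos (2 * pi * snd z $ i)), (\<chi> i. sin (2 * pi * snd z $ i)))"

lemma torus_embedding_component:
  assumes "b \<in> Basis"
  shows "(\<lambda>z. torus_embedding z \<bullet> b) \<in> trig_poly"
proof -
  have cos: "(\<lambda>z :: real \<times> (real ^ 'd). cos (2 * pi * snd z $ i)) \<in> trig_poly" for i
    using trig_poly.mode[OF int_lattice_simps(2), of 1 0 i 0] by (simp add: inner_axis')
  have sin: "(\<lambda>z :: real \<times> (real ^ 'd). sin (2 * pi * snd z $ i)) \<in> trig_poly" for i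
    using trig_poly.mode[OF int_lattice_simps(2), of 1 0 i "- pi / 2"] by (simp add: inner_axis' cos_diff)
  have id: "(\<lambda>z :: real \<times> (real ^ 'd). fst z) \<in> trig_poly"
    using trig_poly.mode[OF int_lattice_simps(1), of 1 1 0] by simp
  from assms consider "b = (1, 0, 0)" | i where "b = (0, axis i 1, 0)" | i where "b = (0, 0, axis i 1)"
    by (auto simp: Basis_prod_def Basis_vec_def zero_prod_def)
  then show ?thesis
    using cos sin id by cases (simp_all add: torus_embedding_def inner_axis)
qed

lemma polynomial_of_embedding_trig_poly:
  assumes "real_polynomial_function g"
  shows "(\<lambda>z. g (torus_embedding z)) \<in> trig_poly"
  using assms
proof induction
  case (linear f)
  then interpret f: bounded_linear f .
  have "f x = (\<Sum>b\<in>Basis. f b * (x \<bullet> b))" for x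
  proof -
    have "f x = f (\<Sum>b\<in>Basis. (x \<bullet> b) *\<^sub>R b)" by (simp add: euclidean_representation)
    also have "\<dots> = (\<Sum>b\<in>Basis. f b * (x \<bullet> b))" by (simp add: f.sum f.scaleR mult.commute)
    finally show ?thesis .
  qed
  then have "(\<lambda>z. f (torus_embedding z)) = (\<lambda>z. \<Sum>b\<in>Basis. f b * (torus_embedding z \<bullet> b))"
    by (rule ext)
  then show ?case
    by (rule ssubst)
      (rule trig_poly_sum[OF finite_Basis], rule trig_poly_mult[OF trig_poly_const torus_embedding_component])
next
  case (const c)
  show ?case by (rule trig_poly_const)
next
  case (add f g)
  then show ?case by (intro trig_poly.add)
next
  case (mult f g)
  then show ?case by (intro trig_poly_mult)
qed

lemma continuous_torus_embedding: "continuous_on UNIV torus_embedding"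
  unfolding torus_embedding_def
  by (intro continuous_on_Pair continuous_on_vec_lambda continuous_on_cos continuous_on_sin continuous_on_mult
      continuous_on_const continuous_on_component continuous_on_fst continuous_on_snd continuous_on_id)

lemma torus_embedding_eqD:
  assumes "torus_embedding (t, y) = torus_embedding (t', y')"
  shows "t = t'" "y - y' \<in> int_lattice"
proof -
  show "t = t'" using assms by (simp add: torus_embedding_def)
  have "(y - y') $ i \<in> \<int>" for i
  proof -
    have "cos (2 * pi * y $ i) = cos (2 * pi * y' $ i)" "sin (2 * pi * y $ i) = sin (2 * pi * y' $ i)"
      using assms by (auto simp: torus_embedding_def vec_eq_iff)
    then obtain n :: int where "2 * pi * y $ i = 2 * pi * y' $ i + 2 * pi * n"
      using sin_cos_eq_iff by blast
    then have "2 * pi * (y $ i) = 2 * pi * (y' $ i + n)" by (simp add: algebra_simps)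
    then have "y $ i = y' $ i + n" by (subst (asm) mult_cancel_left) simp
    then show ?thesis by simp
  qed
  then show "y - y' \<in> int_lattice" by (simp add: int_lattice_def)
qed

lemma torus_embedding_periodic:
  assumes "k \<in> int_lattice"
  shows "torus_embedding (t, y + k) = torus_embedding (t, y)"
proof -
  have "sin (2 * pi * (y + k) $ i) = sin (2 * pi * y $ i) \<and> cos (2 * pi * (y + k) $ i) = cos (2 * pi * y $ i)" for i
  proof -
    obtain n :: int where "k $ i = n" using assms by (auto simp: int_lattice_def elim: Ints_cases)
    then show ?thesis
      by (subst sin_cos_eq_iff) (auto simp: algebra_simps)
  qed
  then show ?thesis by (simp add: torus_embedding_def)
qed

lemma unit_cube_representative:
  fixes y :: "real ^ 'd"
  obtains y0 k where "y0 \<in> cbox 0 1" "k \<in> int_lattice" "y = y0 + k"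
proof
  show "(\<chi> i. frac (y $ i)) \<in> cbox 0 (1 :: real ^ 'd)"
    by (auto simp: mem_box_cart frac_lt_1 less_imp_le)
  show "(\<chi> i. of_int \<lfloor>y $ i\<rfloor>) \<in> int_lattice" by (simp add: int_lattice_def)
  show "y = (\<chi> i. frac (y $ i)) + (\<chi> i. of_int \<lfloor>y $ i\<rfloor>)" by (simp add: vec_eq_iff frac_def)
qed

text \<open>The torus is embedded into Euclidean space by sines and cosines; a continuous periodic function
  factors through the compact image of a period cell, and polynomials in the embedding coordinates are
  trigonometric polynomials. So the polynomial Stone-Weierstrass theorem applies.\<close>

lemma trig_poly_dense:
  fixes F :: "real \<times> (real ^ 'd) \<Rightarrow> real"
  assumes cont: "continuous_on UNIV F" and per: "\<And>t y k. k \<in> int_lattice \<Longrightarrow> F (t, y + k) = F (t, y)"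
    and "0 < \<epsilon>"
  obtains a where "a \<in> trig_poly" "\<And>t y. 0 \<le> t \<Longrightarrow> t \<le> M \<Longrightarrow> \<bar>F (t, y) - a (t, y)\<bar> < \<epsilon>"
proof -
  define K where "K = {0..M} \<times> cbox 0 (1 :: real ^ 'd)"
  let ?S = "torus_embedding ` K"
  have "compact K" by (simp add: K_def compact_Times)
  have F_eq: "F z = F z'" if "torus_embedding z = torus_embedding z'" for z z'
  proof -
    have "torus_embedding (fst z, snd z) = torus_embedding (fst z', snd z')" using that by simp
    from torus_embedding_eqD[OF this] have "fst z = fst z'" "snd z - snd z' \<in> int_lattice" .
    then show ?thesis using per[of "snd z - snd z'" "fst z'" "snd z'"] by (metis add.commute diff_add_cancel prod.collapse)
  qed
  define G where "G w = F (SOME z. z \<in> K \<and> torus_embedding z = w)" for w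
  have G: "G (torus_embedding z) = F z" if "z \<in> K" for z
    unfolding G_def
  proof (rule someI2)
    show "z \<in> K \<and> torus_embedding z = torus_embedding z" using that by simp
    show "F z' = F z" if "z' \<in> K \<and> torus_embedding z' = torus_embedding z" for z'
      using that by (intro F_eq) simp
  qed
  have "compact ?S"
    by (rule compact_continuous_image[OF continuous_on_subset[OF continuous_torus_embedding] \<open>compact K\<close>]) simp
  have "continuous_on ?S G"
  proof (subst continuous_on_closed_vimage)
    show "closed ?S" by (rule compact_imp_closed[OF \<open>compact ?S\<close>])
    show "\<forall>B. closed B \<longrightarrow> closed (G -` B \<inter> ?S)"
    proof (intro allI impI)
      fix B :: "real set" assume "closed B"
      then have "closed (F -` B)"
        using cont by (rule closed_vimage)
      then have "compact (F -` B \<inter> K)" using \<open>compact K\<close> by (simp add: closed_Int_compact)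
      then have "compact (torus_embedding ` (F -` B \<inter> K))"
        by (intro compact_continuous_image continuous_on_subset[OF continuous_torus_embedding]) auto
      moreover have "G -` B \<inter> ?S = torus_embedding ` (F -` B \<inter> K)"
        using G by (auto simp: image_iff)
      ultimately show "closed (G -` B \<inter> ?S)" by (simp add: compact_imp_closed)
    qed
  qed
  from Stone_Weierstrass_real_polynomial_function[OF \<open>compact ?S\<close> this \<open>0 < \<epsilon>\<close>]
  obtain g where g: "real_polynomial_function g" "\<And>w. w \<in> ?S \<Longrightarrow> \<bar>G w - g w\<bar> < \<epsilon>" by blast
  show ?thesis
  proof (rule that[OF polynomial_of_embedding_trig_poly[OF g(1)]])
    fix t and y :: "real ^ 'd" assume t: "0 \<le> t" "t \<le> M"
    obtain y0 k where y: "y0 \<in> cbox 0 1" "k \<in> int_lattice" "y = y0 + k"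
      using unit_cube_representative by blast
    then have "(t, y0) \<in> K" using t by (simp add: K_def)
    then show "\<bar>F (t, y) - g (torus_embedding (t, y))\<bar> < \<epsilon>"
      using g(2)[of "torus_embedding (t, y0)"] G[of "(t, y0)"] per[OF y(2)] torus_embedding_periodic[OF y(2)] y(3)
      by simp
  qed
qed

section \<open>Averages over the torus and the line\<close>

lemma lborel_prod_over_Basis:
  fixes f :: "'a::euclidean_space \<Rightarrow> real \<Rightarrow> complex"
  assumes f: "\<And>b. b \<in> Basis \<Longrightarrow> integrable lborel (f b)"
  shows "integrable lborel (\<lambda>x. \<Prod>b\<in>Basis. f b (x \<bullet> b))"
    and "(LINT x|lborel. (\<Prod>b\<in>Basis. f b (x \<bullet> b))) = (\<Prod>b\<in>Basis. (LINT x|lborel. f b x))"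
proof -
  interpret product_sigma_finite "\<lambda>b::'a. lborel :: real measure" by standard
  let ?g = "\<lambda>x::'a. \<Prod>b\<in>Basis. f b (x \<bullet> b)"
  let ?M = "\<Pi>\<^sub>M b\<in>(Basis :: 'a set). (lborel :: real measure)"
  let ?T = "\<lambda>x::'a \<Rightarrow> real. \<Sum>b\<in>Basis. x b *\<^sub>R b"
  have [measurable]: "f b \<in> borel_measurable borel" if "b \<in> Basis" for b
    using borel_measurable_integrable[OF f[OF that]] by simp
  have T: "?T \<in> ?M \<rightarrow>\<^sub>M borel" by measurable
  have g: "?g \<in> borel_measurable borel" by measurable
  have eq: "?g (?T x) = (\<Prod>b\<in>Basis. f b (x b))" for x
    by (intro prod.cong refl) simp
  have "integrable ?M (\<lambda>x. \<Prod>b\<in>Basis. f b (x b))"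
    by (rule product_integrable_prod) (auto intro: f)
  then show "integrable lborel ?g"
    by (subst lborel_eq, subst integrable_distr_eq[OF T g]) (simp only: eq)
  have "(LINT x|lborel. ?g x) = (LINT x|?M. ?g (?T x))"
    by (subst lborel_eq, subst integral_distr[OF T g]) (rule refl)
  also have "\<dots> = (LINT x|?M. (\<Prod>b\<in>Basis. f b (x b)))" by (simp only: eq)
  also have "\<dots> = (\<Prod>b\<in>Basis. (LINT x|lborel. f b x))"
    by (rule product_integral_prod) (auto intro: f)
  finally show "(LINT x|lborel. ?g x) = (\<Prod>b\<in>Basis. (LINT x|lborel. f b x))" .
qed

lemma unit_interval_mode:
  fixes c :: complex
  assumes "c \<noteq> 0"
  shows "integrable lborel (\<lambda>x::real. indicator {0..1} x *\<^sub>R exp (c * of_real x))"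
    and "(LINT x|lborel. indicator {0..1} x *\<^sub>R exp (c * of_real x)) = (exp c - 1) / c"
proof -
  have "((\<lambda>z. exp (c * z) / c) has_field_derivative exp (c * of_real x)) (at (of_real x))" for x :: real
    using assms by (auto intro!: derivative_eq_intros)
  then have "((\<lambda>x. exp (c * of_real x) / c) has_vector_derivative exp (c * of_real x)) (at x within {0..1})" for x :: real
    by (rule has_vector_derivative_real_field)
  then have "has_bochner_integral lborel (\<lambda>x::real. indicator {0..1} x *\<^sub>R exp (c * of_real x))
      (exp (c * of_real 1) / c - exp (c * of_real 0) / c)"
    by (intro has_bochner_integral_FTC_Icc) (auto intro!: continuous_intros)
  then show "integrable lborel (\<lambda>x::real. indicator {0..1} x *\<^sub>R exp (c * of_real x))"
    "(LINT x|lborel. indicator {0..1} x *\<^sub>R exp (c * of_real x)) = (exp c - 1) / c"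
    by (auto simp: has_bochner_integral_iff diff_divide_distrib)
qed

lemma indicator_unit_cube:
  fixes y :: "real ^ 'd"
  shows "(\<Prod>b\<in>Basis. indicator {0..1} (y \<bullet> b)) = (indicator (cbox 0 1) y :: real)"
proof (cases "y \<in> cbox 0 1")
  case True
  then show ?thesis
    by (auto simp: Basis_vec_def inner_axis mem_box_cart intro!: prod.neutral)
next
  case False
  then obtain i where "y $ i \<notin> {0..1}" by (auto simp: mem_box_cart)
  then have "\<exists>b\<in>Basis. indicator {0..1} (y \<bullet> b) = (0::real)"
    by (intro bexI[of _ "axis i 1"]) (auto simp: inner_axis axis_in_Basis_iff)
  then show ?thesis using False by (simp add: prod_zero)
qed

lemma unit_cube_integral:
  shows "integrable lborel (indicator (cbox 0 (1 :: real ^ 'd)) :: _ \<Rightarrow> real)"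
    and "measure lborel (cbox 0 (1 :: real ^ 'd)) = 1"
proof -
  show "integrable lborel (indicator (cbox 0 (1 :: real ^ 'd)) :: _ \<Rightarrow> real)"
    by (rule integrable_real_indicator) (auto simp: emeasure_lborel_cbox_eq)
  have "(1 :: real ^ 'd) \<bullet> b = 1" if "b \<in> Basis" for b
    using that by (auto simp: Basis_vec_def inner_axis)
  then show "measure lborel (cbox 0 (1 :: real ^ 'd)) = 1"
    by (simp add: measure_lborel_cbox_eq)
qed

text \<open>The complex exponential is a product over the coordinates, and the factor of a coordinate with
  nonzero frequency integrates to \<open>0\<close> over a period.\<close>

lemma cube_mode_integral:
  fixes k :: "real ^ 'd"
  assumes k: "k \<in> int_lattice" "k \<noteq> 0"
  shows "(LINT y|lborel. indicator (cbox 0 1) y * cos (2 * pi * (k \<bullet> y) + \<phi>)) = 0"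
proof -
  define c where "c b = \<i> * of_real (2 * pi * (k \<bullet> b))" for b
  define f where "f b x = indicator {0..1} x *\<^sub>R exp (c b * of_real x)" for b and x :: real
  obtain i where i: "k $ i \<noteq> 0" using k(2) by (auto simp: vec_eq_iff)
  have "integrable lborel (indicator {0..1} :: real \<Rightarrow> real)" by (rule integrable_real_indicator) auto
  then have int0: "integrable lborel (\<lambda>x::real. complex_of_real (indicator {0..1} x))"
    by (rule integrable_of_real)
  have f: "integrable lborel (f b)" for b
  proof (cases "c b = 0")
    case True
    have "f b = (\<lambda>x. of_real (indicator {0..1} x))" by (auto simp: f_def True indicator_def)
    then show ?thesis using int0 by simp
  next
    case False
    then show ?thesis unfolding f_def by (rule unit_interval_mode)
  qed
  have "(LINT x|lborel. f (axis i 1) x) = 0"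
  proof -
    have c: "c (axis i 1) = 2 * of_real (k $ i) * pi * \<i>" by (simp add: c_def inner_axis)
    have "c (axis i 1) \<noteq> 0" using i by (simp add: c)
    moreover have "exp (c (axis i 1)) = 1"
      unfolding c by (rule exp_integer_2pi) (use k(1) in \<open>auto simp: int_lattice_def elim!: Ints_cases\<close>)
    ultimately show ?thesis unfolding f_def by (subst unit_interval_mode) auto
  qed
  moreover have "axis i 1 \<in> (Basis :: (real ^ 'd) set)" by (simp add: axis_in_Basis_iff)
  ultimately have "(\<Prod>b\<in>(Basis :: (real ^ 'd) set). (LINT x|lborel. f b x)) = 0"
    by (intro prod_zero[OF finite_Basis] bexI[of _ "axis i 1"])
  then have zero: "(LINT y|lborel. (\<Prod>b\<in>Basis. f b (y \<bullet> b))) = 0"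
    using lborel_prod_over_Basis(2)[of f, OF f] by simp
  have eq: "indicator (cbox 0 1) y * cos (2 * pi * (k \<bullet> y) + \<phi>) =
      Re (exp (\<i> * of_real \<phi>) * (\<Prod>b\<in>Basis. f b (y \<bullet> b)))" for y :: "real ^ 'd"
  proof -
    have "(\<Prod>b\<in>Basis. f b (y \<bullet> b)) =
        of_real (\<Prod>b\<in>Basis. indicator {0..1} (y \<bullet> b)) * (\<Prod>b\<in>Basis. exp (c b * of_real (y \<bullet> b)))"
      by (simp add: f_def scaleR_conv_of_real prod.distrib)
    also have "(\<Prod>b\<in>Basis. exp (c b * of_real (y \<bullet> b))) = exp (\<Sum>b\<in>Basis. c b * of_real (y \<bullet> b))"
      by (simp add: exp_sum)
    also have "(\<Sum>b\<in>Basis. c b * of_real (y \<bullet> b)) = \<i> * of_real (2 * pi * (k \<bullet> y))"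
      by (subst euclidean_inner[of k y]) (simp add: c_def sum_distrib_left mult.assoc)
    finally have "exp (\<i> * of_real \<phi>) * (\<Prod>b\<in>Basis. f b (y \<bullet> b)) =
        of_real (indicator (cbox 0 1) y) * exp (\<i> * of_real (2 * pi * (k \<bullet> y) + \<phi>))"
      by (simp add: indicator_unit_cube exp_add distrib_left mult_ac)
    then show ?thesis by (simp add: Re_exp)
  qed
  have "(LINT y|lborel. Re (exp (\<i> * of_real \<phi>) * (\<Prod>b\<in>Basis. f b (y \<bullet> b)))) =
      Re (exp (\<i> * of_real \<phi>) * (LINT y|lborel. (\<Prod>b\<in>Basis. f b (y \<bullet> b))))"
    using lborel_prod_over_Basis(1)[of f, OF f] by (subst integral_Re) auto
  then show ?thesis by (simp only: eq zero) simp
qed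

lemma lborel_tensor_integral:
  fixes f :: "'a::euclidean_space \<Rightarrow> real" and g :: "'b::euclidean_space \<Rightarrow> real"
  assumes f: "integrable lborel f" and g: "integrable lborel g"
  shows "integrable lborel (\<lambda>z. f (fst z) * g (snd z))"
    and "(LINT z|lborel. f (fst z) * g (snd z)) = (LINT x|lborel. f x) * (LINT y|lborel. g y)"
proof -
  have [measurable]: "f \<in> borel_measurable borel" "g \<in> borel_measurable borel"
    using borel_measurable_integrable[OF f] borel_measurable_integrable[OF g] by simp_all
  have int: "integrable (lborel \<Otimes>\<^sub>M lborel) (\<lambda>z. f (fst z) * g (snd z))"
  proof (rule lborel_pair.Fubini_integrable)
    show "(\<lambda>z. f (fst z) * g (snd z)) \<in> borel_measurable (lborel \<Otimes>\<^sub>M lborel)" by measurable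
    have "(\<lambda>x. LINT y|lborel. norm (f (fst (x, y)) * g (snd (x, y)))) = (\<lambda>x. norm (f x) * (LINT y|lborel. norm (g y)))"
      by (simp add: abs_mult)
    then show "integrable lborel (\<lambda>x. LINT y|lborel. norm (f (fst (x, y)) * g (snd (x, y))))"
      using f by simp
  qed (use g in auto)
  show "integrable lborel (\<lambda>z. f (fst z) * g (snd z))"
    using int by (simp only: lborel_prod)
  have "(LINT z|lborel. f (fst z) * g (snd z)) = (LINT x|lborel. (LINT y|lborel. f (fst (x, y)) * g (snd (x, y))))"
    using lborel_pair.integral_fst'[OF int] by (simp only: lborel_prod)
  also have "\<dots> = (LINT x|lborel. f x) * (LINT y|lborel. g y)" by simp
  finally show "(LINT z|lborel. f (fst z) * g (snd z)) = (LINT x|lborel. f x) * (LINT y|lborel. g y)" .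
qed

lemma continuous_trig_poly: "a \<in> trig_poly \<Longrightarrow> continuous_on UNIV a"
  by (induction rule: trig_poly.induct) (auto intro!: continuous_intros)

lemma bounded_trig_poly: "a \<in> trig_poly \<Longrightarrow> \<exists>B. \<forall>z. \<bar>fst z\<bar> \<le> M \<longrightarrow> \<bar>a z\<bar> \<le> B"
proof (induction rule: trig_poly.induct)
  case (mode k c n \<phi>)
  have "\<bar>c * fst z ^ n * cos (2 * pi * (k \<bullet> snd z) + \<phi>)\<bar> \<le> \<bar>c\<bar> * M ^ n * 1" if "\<bar>fst z\<bar> \<le> M" for z :: "real \<times> (real ^ 'a)"
    using that unfolding abs_mult power_abs by (intro mult_mono power_mono) auto
  then show ?case by blast
next
  case (add f g)
  then obtain B C where "\<And>z. \<bar>fst z\<bar> \<le> M \<Longrightarrow> \<bar>f z\<bar> \<le> B" "\<And>z. \<bar>fst z\<bar> \<le> M \<Longrightarrow> \<bar>g z\<bar> \<le> C" by blast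
  then have "\<bar>f z + g z\<bar> \<le> B + C" if "\<bar>fst z\<bar> \<le> M" for z
    using that by (meson abs_triangle_ineq add_mono order_trans)
  then show ?case by blast
qed

context allen_cahn_wave begin

text \<open>Divided by \<open>c_wave q\<close>, this is the probability density against which the mobility is averaged.
  Averages are taken of functions of \<open>(t, y)\<close>, with the speed \<open>q'(s)\<close> substituted for \<open>t\<close>.\<close>

definition wave_weight :: "real \<times> (real ^ 'd) \<Rightarrow> real" where
  "wave_weight z = (deriv q (fst z))\<^sup>2 * indicator (cbox 0 1) (snd z)"

definition wave_mean :: "(real \<times> (real ^ 'd) \<Rightarrow> real) \<Rightarrow> real" where
  "wave_mean b = inverse (c_wave q) * (LINT z|lborel. wave_weight z * b (deriv q (fst z), snd z))"

lemma velocity_square_integrable: "integrable lborel (\<lambda>s. (deriv q s)\<^sup>2)"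
  using weight_integrable[of "\<lambda>_. 1"] by simp

lemma c_wave_pos: "0 < c_wave q"
proof -
  have "c_wave q \<noteq> 0"
  proof
    assume "c_wave q = 0"
    then have "AE s in lborel. (deriv q s)\<^sup>2 = 0"
      unfolding c_wave_def by (subst (asm) integral_nonneg_eq_0_iff_AE[OF velocity_square_integrable]) auto
    then have "AE s in (lborel :: real measure). False"
      using velocity_pos by (auto elim!: AE_mp simp: less_imp_neq[THEN not_sym])
    then show False by (simp add: AE_iff_null null_sets_def)
  qed
  moreover have "0 \<le> c_wave q" unfolding c_wave_def by simp
  ultimately show ?thesis by simp
qed

lemma wave_weight_integrable: "integrable lborel (wave_weight :: real \<times> (real ^ 'd) \<Rightarrow> real)"
  and wave_weight_integral: "(LINT z|lborel. wave_weight (z :: real \<times> (real ^ 'd))) = c_wave q"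
proof -
  note lborel_tensor_integral[OF velocity_square_integrable unit_cube_integral(1)[where 'd = 'd]]
  then show "integrable lborel (wave_weight :: real \<times> (real ^ 'd) \<Rightarrow> real)"
    "(LINT z|lborel. wave_weight (z :: real \<times> (real ^ 'd))) = c_wave q"
    using unit_cube_integral(2)[where 'd = 'd] by (simp_all add: wave_weight_def[abs_def] c_wave_def)
qed

lemma wave_weight_nonneg: "0 \<le> wave_weight z"
  by (simp add: wave_weight_def)

lemma wave_mean_integrable:
  fixes b :: "real \<times> (real ^ 'd) \<Rightarrow> real"
  assumes b: "continuous_on UNIV b" and bd: "\<And>s y. \<bar>b (deriv q s, y)\<bar> \<le> B"
  shows "integrable lborel (\<lambda>z. wave_weight z * b (deriv q (fst z), snd z))"
proof (rule Bochner_Integration.integrable_bound[OF integrable_mult_right[OF wave_weight_integrable, of B]])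
  have "continuous_on UNIV (\<lambda>z :: real \<times> (real ^ 'd). deriv q (fst z))"
    by (rule continuous_on_compose2[OF velocity_continuous continuous_on_fst[OF continuous_on_id]]) simp
  then have "continuous_on UNIV (\<lambda>z :: real \<times> (real ^ 'd). b (deriv q (fst z), snd z))"
    by (intro continuous_on_compose2[OF b continuous_on_Pair] continuous_intros) auto
  then have "(\<lambda>z. b (deriv q (fst z), snd z)) \<in> borel_measurable borel"
    by (rule borel_measurable_continuous_onI)
  moreover have "wave_weight \<in> borel_measurable (borel :: (real \<times> (real ^ 'd)) measure)"
    using borel_measurable_integrable[OF wave_weight_integrable] by simp
  ultimately show "(\<lambda>z. wave_weight z * b (deriv q (fst z), snd z)) \<in> borel_measurable lborel"
    by simp
  show "AE z in lborel. norm (wave_weight z * b (deriv q (fst z), snd z)) \<le> norm (B * wave_weight z)"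
  proof (rule AE_I2)
    fix z :: "real \<times> (real ^ 'd)"
    have "norm (wave_weight z * b (deriv q (fst z), snd z)) = wave_weight z * \<bar>b (deriv q (fst z), snd z)\<bar>"
      using wave_weight_nonneg[of z] by (simp add: abs_mult)
    also have "\<dots> \<le> wave_weight z * B"
      by (rule mult_left_mono[OF bd wave_weight_nonneg])
    also have "\<dots> \<le> norm (B * wave_weight z)" by (simp add: mult.commute)
    finally show "norm (wave_weight z * b (deriv q (fst z), snd z)) \<le> norm (B * wave_weight z)" .
  qed
qed

lemma trig_poly_wave_integrable:
  fixes a :: "real \<times> (real ^ 'd) \<Rightarrow> real"
  assumes "a \<in> trig_poly"
  shows "integrable lborel (\<lambda>z. wave_weight z * a (deriv q (fst z), snd z))"
proof -
  obtain M where "\<And>s. \<bar>deriv q s\<bar> \<le> M" using velocity_bounded by (auto simp: bounded_iff)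
  moreover obtain B where "\<And>z. \<bar>fst z\<bar> \<le> M \<Longrightarrow> \<bar>a z\<bar> \<le> B" using bounded_trig_poly[OF assms] by blast
  ultimately show ?thesis by (intro wave_mean_integrable[OF continuous_trig_poly[OF assms], of B]) simp
qed

lemma wave_mean_add:
  assumes "f \<in> trig_poly" "g \<in> trig_poly"
  shows "wave_mean (\<lambda>z. f z + g z) = wave_mean f + wave_mean g"
  using trig_poly_wave_integrable[OF assms(1)] trig_poly_wave_integrable[OF assms(2)]
  by (simp add: wave_mean_def distrib_left)

lemma wave_mean_mode:
  fixes k :: "real ^ 'd"
  assumes "k \<in> int_lattice"
  shows "wave_mean (\<lambda>z. c * fst z ^ n * cos (2 * pi * (k \<bullet> snd z) + \<phi>)) =
    (if k = 0 then c * cos \<phi> * inverse (c_wave q) * (LINT s|lborel. deriv q s ^ n * (deriv q s)\<^sup>2) else 0)"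
proof -
  let ?g = "\<lambda>y. indicator (cbox 0 1) y * cos (2 * pi * (k \<bullet> y) + \<phi>)"
  have pn: "bounded_lipschitz (\<lambda>s. deriv q s ^ n)"
    by (rule bounded_lipschitz_power[OF velocity_lipschitz])
  have f: "integrable lborel (\<lambda>s. deriv q s ^ n * (deriv q s)\<^sup>2)"
    by (rule weight_integrable[OF bounded_lipschitz_imp_continuous[OF pn] bounded_lipschitz_imp_bounded[OF pn]])
  have g: "integrable lborel ?g"
  proof (rule Bochner_Integration.integrable_bound[of lborel "indicator (cbox 0 1) :: _ \<Rightarrow> real"])
    show "integrable lborel (indicator (cbox 0 (1 :: real ^ 'd)) :: _ \<Rightarrow> real)"
      by (rule unit_cube_integral)
    have "(\<lambda>y. cos (2 * pi * (k \<bullet> y) + \<phi>)) \<in> borel_measurable borel"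
      by (intro borel_measurable_continuous_onI continuous_intros)
    then show "?g \<in> borel_measurable lborel" by simp
  qed (auto simp: indicator_def)
  have "(LINT z|lborel. wave_weight z * (c * deriv q (fst z) ^ n * cos (2 * pi * (k \<bullet> snd z) + \<phi>)))
      = (LINT z|lborel. c * (deriv q (fst z) ^ n * (deriv q (fst z))\<^sup>2 * ?g (snd z)))"
    by (intro arg_cong[where f = "integral\<^sup>L lborel"] ext) (simp add: wave_weight_def)
  also have "\<dots> = c * ((LINT s|lborel. deriv q s ^ n * (deriv q s)\<^sup>2) * (LINT y|lborel. ?g y))"
    using lborel_tensor_integral[OF f g] by simp
  also have "(LINT y|lborel. ?g y) = (if k = 0 then cos \<phi> else 0)"
    using cube_mode_integral[OF assms, of \<phi>] unit_cube_integral(2)[where 'd = 'd] by simp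
  finally show ?thesis by (simp add: wave_mean_def)
qed

section \<open>Exact solutions for trigonometric mobilities\<close>

text \<open>For a mode with \<open>k \<noteq> 0\<close> the average vanishes; for \<open>k = 0\<close> it is exactly what makes the forcing
  orthogonal to \<open>q'\<close>. Sums are handled by linearity of the operator and of the average.\<close>

lemma trig_poly_solvable:
  fixes a :: "real \<times> (real ^ 'd) \<Rightarrow> real"
  assumes e: "norm e = 1" "e \<notin> rational_directions" and \<mu>: "0 < \<mu>" "\<mu> < 1" and "a \<in> trig_poly"
  shows "\<exists>P\<in>C2_holder \<mu>. \<forall>s y. (a (deriv q s, y) - wave_mean a) * deriv q s
    + D_adj e (D_op e P) (s, y) + W2 (q s) * P (s, y) = 0"
  using \<open>a \<in> trig_poly\<close>
proof (induction rule: trig_poly.induct)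
  case (mode k c n \<phi>)
  define A where "A = (if k = 0 then inverse (c_wave q) * (LINT s|lborel. deriv q s ^ n * (deriv q s)\<^sup>2) else 0)"
  define h where "h s = - c * (deriv q s ^ n - A)" for s
  have pn: "bounded_lipschitz (\<lambda>s. deriv q s ^ n)"
    by (rule bounded_lipschitz_power[OF velocity_lipschitz])
  have h: "bounded_lipschitz h"
    unfolding h_def by (intro bounded_lipschitz_mult bounded_lipschitz_diff bounded_lipschitz_const pn)
  have "(LINT s|lborel. h s * (deriv q s)\<^sup>2) = 0" if "k = 0"
  proof -
    have int: "integrable lborel (\<lambda>s. deriv q s ^ n * (deriv q s)\<^sup>2)"
      by (rule weight_integrable[OF bounded_lipschitz_imp_continuous[OF pn] bounded_lipschitz_imp_bounded[OF pn]])
    have "(LINT s|lborel. h s * (deriv q s)\<^sup>2) =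
        (LINT s|lborel. - c * (deriv q s ^ n * (deriv q s)\<^sup>2 - A * (deriv q s)\<^sup>2))"
      by (simp add: h_def algebra_simps)
    also have "\<dots> = - c * ((LINT s|lborel. deriv q s ^ n * (deriv q s)\<^sup>2) - A * c_wave q)"
      using int velocity_square_integrable by (simp add: c_wave_def)
    also have "\<dots> = 0" using that c_wave_pos by (simp add: A_def)
    finally show ?thesis .
  qed
  from mode_solvable[OF mode e \<mu> h this, where \<phi> = \<phi>]
  obtain P where P: "P \<in> C2_holder \<mu>" "\<And>s y. D_adj e (D_op e P) (s, y) + W2 (q s) * P (s, y) =
      deriv q s * h s * cos (2 * pi * (k \<bullet> y) + \<phi>)" by blast
  have "wave_mean (\<lambda>z. c * fst z ^ n * cos (2 * pi * (k \<bullet> snd z) + \<phi>)) = c * A * cos (2 * pi * (k \<bullet> y) + \<phi>)" for y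
    unfolding wave_mean_mode[OF mode] by (simp add: A_def)
  then have eq: "(c * deriv q s ^ n * cos (2 * pi * (k \<bullet> y) + \<phi>)
        - wave_mean (\<lambda>z. c * fst z ^ n * cos (2 * pi * (k \<bullet> snd z) + \<phi>))) * deriv q s
      = - (deriv q s * h s * cos (2 * pi * (k \<bullet> y) + \<phi>))" for s y
    by (simp add: h_def algebra_simps)
  show ?case
  proof (intro bexI[OF _ P(1)] allI)
    show "(c * fst (deriv q s, y) ^ n * cos (2 * pi * (k \<bullet> snd (deriv q s, y)) + \<phi>)
        - wave_mean (\<lambda>z. c * fst z ^ n * cos (2 * pi * (k \<bullet> snd z) + \<phi>))) * deriv q s
        + D_adj e (D_op e P) (s, y) + W2 (q s) * P (s, y) = 0" for s y
      unfolding fst_conv snd_conv eq using P(2)[of s y] by linarith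
  qed
next
  case (add f g)
  then obtain P Q where P: "P \<in> C2_holder \<mu>" "\<And>s y. (f (deriv q s, y) - wave_mean f) * deriv q s
      + D_adj e (D_op e P) (s, y) + W2 (q s) * P (s, y) = 0"
    and Q: "Q \<in> C2_holder \<mu>" "\<And>s y. (g (deriv q s, y) - wave_mean g) * deriv q s
      + D_adj e (D_op e Q) (s, y) + W2 (q s) * Q (s, y) = 0" by blast
  show ?case
  proof (intro bexI[OF _ C2_holder_add[OF P(1) Q(1)]] allI)
    fix s y
    show "(f (deriv q s, y) + g (deriv q s, y) - wave_mean (\<lambda>z. f z + g z)) * deriv q s
      + D_adj e (D_op e (\<lambda>z. P z + Q z)) (s, y) + W2 (q s) * (P (s, y) + Q (s, y)) = 0"
      unfolding wave_mean_add[OF add.hyps] D_adj_D_op_add[OF C2_holderD(2)[OF P(1)] C2_holderD(2)[OF Q(1)]]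
      using P(2)[of s y] Q(2)[of s y] by (simp add: algebra_simps)
  qed
qed

section \<open>Arbitrary mobilities\<close>

text \<open>Averaging against a probability density does not increase the uniform distance.\<close>

lemma wave_mean_diff_le:
  fixes F a :: "real \<times> (real ^ 'd) \<Rightarrow> real"
  assumes F: "integrable lborel (\<lambda>z. wave_weight z * F (deriv q (fst z), snd z))"
    and a: "integrable lborel (\<lambda>z. wave_weight z * a (deriv q (fst z), snd z))"
    and le: "\<And>s y. \<bar>F (deriv q s, y) - a (deriv q s, y)\<bar> \<le> \<epsilon>"
  shows "\<bar>wave_mean F - wave_mean a\<bar> \<le> \<epsilon>"
proof -
  let ?d = "\<lambda>z. wave_weight z * F (deriv q (fst z), snd z) - wave_weight z * a (deriv q (fst z), snd z)"
  have "\<bar>LINT z|lborel. ?d z\<bar> \<le> (LINT z|lborel. \<bar>?d z\<bar>)" by (rule integral_abs_bound)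
  also have "\<dots> \<le> (LINT z|lborel. \<epsilon> * wave_weight (z :: real \<times> (real ^ 'd)))"
  proof (rule integral_mono)
    show "integrable lborel (\<lambda>z. \<bar>?d z\<bar>)" using F a by auto
    show "integrable lborel (\<lambda>z :: real \<times> (real ^ 'd). \<epsilon> * wave_weight z)"
      by (rule integrable_mult_right[OF wave_weight_integrable])
    show "\<bar>?d z\<bar> \<le> \<epsilon> * wave_weight z" for z
    proof -
      have "\<bar>?d z\<bar> = wave_weight z * \<bar>F (deriv q (fst z), snd z) - a (deriv q (fst z), snd z)\<bar>"
        using wave_weight_nonneg[of z] by (simp add: abs_mult flip: right_diff_distrib)
      also have "\<dots> \<le> wave_weight z * \<epsilon>" by (rule mult_left_mono[OF le wave_weight_nonneg])
      finally show ?thesis by (simp add: mult.commute)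
    qed
  qed
  also have "\<dots> = \<epsilon> * c_wave q" by (simp add: wave_weight_integral)
  finally have "\<bar>LINT z|lborel. ?d z\<bar> \<le> \<epsilon> * c_wave q" .
  moreover have "wave_mean F - wave_mean a = inverse (c_wave q) * (LINT z|lborel. ?d z)"
    using F a by (simp add: wave_mean_def right_diff_distrib)
  ultimately have "\<bar>wave_mean F - wave_mean a\<bar> \<le> inverse (c_wave q) * (\<epsilon> * c_wave q)"
    using c_wave_pos by (simp only: abs_mult) (intro mult_mono; simp)
  also have "\<dots> = \<epsilon>" using c_wave_pos by (simp add: field_simps)
  finally show ?thesis .
qed

lemma mean_mobility_eq_wave_mean: "mean_mobility m q e = wave_mean (\<lambda>z. m (snd z, fst z *\<^sub>R e))"
  unfolding mean_mobility_def wave_mean_def set_lebesgue_integral_def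
  by (intro arg_cong2[where f = "(*)"] refl arg_cong[where f = "integral\<^sup>L lborel"] ext)
    (auto simp: wave_weight_def indicator_def mem_Times_iff)

end

theorem theorem4:
  fixes m :: "(real ^ 'd) \<times> (real ^ 'd) \<Rightarrow> real"
    and W q :: "real \<Rightarrow> real"
    and \<mu> :: real
    and e :: "real ^ 'd"
  assumes "admissible_mobility m"
    and "double_well W"
    and "standing_wave W q"
    and "0 < \<mu>" and "\<mu> < 1"
    and "e \<in> sphere 0 1 - rational_directions"
  shows "\<forall>\<nu>>0. \<exists>P\<in>C2_holder \<mu>. \<forall>s y.
           \<bar>(m (y, deriv q s *\<^sub>R e) - mean_mobility m q e) * deriv q s
             + D_adj e (D_op e P) (s, y)
             + icc_deriv (icc_deriv W) (q s) * P (s, y)\<bar> \<le> \<nu> * deriv q s"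
proof (intro allI impI)
  fix \<nu> :: real assume "0 < \<nu>"
  interpret allen_cahn_wave W q using assms by unfold_locales
  have e: "norm e = 1" "e \<notin> rational_directions" using assms(6) by auto
  define F where "F z = m (snd z, fst z *\<^sub>R e)" for z
  have m: "\<And>y v k. k \<in> int_lattice \<Longrightarrow> m (y + k, v) = m (y, v)" "continuous_on UNIV m"
    "bdd_below (range m)" "bdd_above (range m)"
    using assms(1) by (simp_all add: admissible_mobility_def)
  have F: "continuous_on UNIV F"
    unfolding F_def by (intro continuous_on_compose2[OF m(2) continuous_on_Pair] continuous_intros) auto
  obtain B where B: "\<And>z. \<bar>m z\<bar> \<le> B"
  proof -
    obtain l u where "\<And>z. l \<le> m z" "\<And>z. m z \<le> u"
      using m(3,4) by (auto simp: bdd_below_def bdd_above_def)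
    then show ?thesis using that[of "max \<bar>l\<bar> \<bar>u\<bar>"] by (smt (verit))
  qed
  obtain M where M: "\<And>s. \<bar>deriv q s\<bar> \<le> M" using velocity_bounded by (auto simp: bounded_iff)
  have F_per: "F (t, y + k) = F (t, y)" if "k \<in> int_lattice" for t y k
    using m(1)[OF that] by (simp add: F_def)
  obtain a where a: "a \<in> trig_poly" "\<And>t y. 0 \<le> t \<Longrightarrow> t \<le> M \<Longrightarrow> \<bar>F (t, y) - a (t, y)\<bar> < \<nu> / 2"
    using trig_poly_dense[OF F F_per, of "\<nu> / 2" M] \<open>0 < \<nu>\<close> by auto
  have close: "\<bar>F (deriv q s, y) - a (deriv q s, y)\<bar> \<le> \<nu> / 2" for s y
    using a(2)[of "deriv q s" y] velocity_pos[of s] M[of s] by simp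
  have "\<bar>wave_mean F - wave_mean a\<bar> \<le> \<nu> / 2"
  proof (rule wave_mean_diff_le[OF _ trig_poly_wave_integrable[OF a(1)] close])
    show "integrable lborel (\<lambda>z. wave_weight z * F (deriv q (fst z), snd z))"
      by (rule wave_mean_integrable[OF F, of B]) (simp add: F_def B)
  qed
  then have mean: "\<bar>mean_mobility m q e - wave_mean a\<bar> \<le> \<nu> / 2"
    unfolding mean_mobility_eq_wave_mean F_def .
  obtain P where P: "P \<in> C2_holder \<mu>" "\<And>s y. (a (deriv q s, y) - wave_mean a) * deriv q s
      + D_adj e (D_op e P) (s, y) + W2 (q s) * P (s, y) = 0"
    using trig_poly_solvable[OF e assms(4,5) a(1)] by blast
  show "\<exists>P\<in>C2_holder \<mu>. \<forall>s y. \<bar>(m (y, deriv q s *\<^sub>R e) - mean_mobility m q e) * deriv q s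
      + D_adj e (D_op e P) (s, y) + W2 (q s) * P (s, y)\<bar> \<le> \<nu> * deriv q s"
  proof (intro bexI[OF _ P(1)] allI)
    fix s y
    have "(m (y, deriv q s *\<^sub>R e) - mean_mobility m q e) * deriv q s
        + D_adj e (D_op e P) (s, y) + W2 (q s) * P (s, y)
      = ((F (deriv q s, y) - a (deriv q s, y)) - (mean_mobility m q e - wave_mean a)) * deriv q s"
      using P(2)[of s y] by (simp add: F_def algebra_simps)
    also have "\<bar>\<dots>\<bar> \<le> \<nu> * deriv q s"
    proof -
      have "\<bar>(F (deriv q s, y) - a (deriv q s, y)) - (mean_mobility m q e - wave_mean a)\<bar> \<le> \<nu>"
        using close[of s y] mean by linarith
      then show ?thesis using velocity_pos[of s] by (simp add: abs_mult)
    qed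
    finally show "\<bar>(m (y, deriv q s *\<^sub>R e) - mean_mobility m q e) * deriv q s
        + D_adj e (D_op e P) (s, y) + W2 (q s) * P (s, y)\<bar> \<le> \<nu> * deriv q s" .
  qed
qed

end
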